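(* Consider a flat Friedmann universe filled with dust and anti-Chaplygin gas, in the vicinity of the soft singularity at $t=t_S$. The scale factor, the Hubble parameter $H=\dot a/a$, its derivative, and the dust energy density are given by their leading terms $$a(t)=a_S-\sqrt{\frac{\rho_{m,0}}{a_S}}\,|t_S-t|-\sqrt{\frac{2Aa_S^2}{3H_S}}\,|t_S-t|^{3/2},$$ $$H(t)=H_S\,\mathrm{sgn}(t_S-t)+\sqrt{\frac{3A}{2H_S}}\;\mathrm{sgn}(t_S-t)\sqrt{|t_S-t|},$$ $$\dot H=-2H_S\,\delta(t_S-t)-\sqrt{\frac{3A}{8H_S}}\;\frac{1}{\sqrt{|t_S-t|}},\qquad \rho_m=H_S^2+3H_S^3|t_S-t| .$$ Define the pressure and the energy density of the anti-Chaplygin gas by $$p_{ACh}=\sqrt{\frac{A}{6H_S|t_S-t|}}+\frac43H_S\,\delta(t_S-t),\qquad \rho_{ACh}=\frac{A}{\sqrt{\frac{A}{6H_S|t_S-t|}}+\frac43H_S\,\delta(t_S-t)},$$ the last expression being understood in the sense of the composition of distributions, so that the equation of state $p=A/\rho$ is preserved. Then $p_{ACh}$ and $\rho_{ACh}$ give a self-consistent solution of the cosmological equations: in the vicinity of $t_S$, where the regular parts of the quantities are given by the leading terms above, the Friedmann equation $H^2=\rho_m+\rho_{ACh}$, the Raychaudhuri equation $\dot H=-\frac32(\rho_m+\rho_{ACh}+p_{ACh})$ and the continuity equation of the anti-Chaplygin gas $\dot\rho_{ACh}+3H(\rho_{ACh}+p_{ACh})=0$ are satisfied in the distributional sense across the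 singularity. In particular: (a) $\rho_{ACh}$ behaves as a continuous function which vanishes at the singularity, and the $\delta$-terms occurring in $\rho_{ACh}$ and $\dot\rho_{ACh}$ can be dropped, so they do not affect the Friedmann equation or the continuity equation; (b) the $\delta$-term in $3Hp_{ACh}$ vanishes, because $H$ changes sign at the singularity; (c) the $\delta$-term in $\dot H$ on the left-hand side of the Raychaudhuri equation is compensated by the $\delta$-term of $p_{ACh}$ on its right-hand side.
   Context: Units $c=1$, $8\pi G/3=1$. The metric is $ds^2=-dt^2+a^2(t)\sum_{\alpha=1}^3(dx^\alpha)^2$; a dot is $d/dt$. The dust is pressureless with $\rho_m=\rho_{m,0}/a^3$; the anti-Chaplygin gas has equation of state $p=A/\rho$, and away from the singularity $\rho_{ACh}=\sqrt{B/a^6-A}$. Here $A,B>0$ and $\rho_{m,0}$ (the dust constant, with $\rho_{m,0}>0$) are constants, $a_S=(B/A)^{1/6}$ is the scale factor at the singularity, $H_S=\sqrt{\rho_{m,0}/a_S^3}$, and $t_S$ is the time of the singularity. The expansion for $t<t_S$ is followed by a contraction for $t>t_S$. Without $\delta$-terms, the leading terms of the anti-Chaplygin gas are $\rho_{ACh}=\sqrt{6AH_S|t_S-t|}$ and $p_{ACh}=\sqrt{A/(6H_S|t_S-t|)}$. $\delta$ is the Dirac delta. Regularization: let $\rho(\tau)$ (unrelated to the energy densities) be any infinitely differentiable function with $\rho(\tau)=0$ for $|\tau|\ge1$, $\rho\ge0$, $\rho(\tau)=\rho(-\tau)$, $\int_{-1}^1\rho\,d\tau=1$; put $\delta_n(\tau)=n\rho(n\tau)$,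 $n=1,2,\dots$, and $f_n=f\ast\delta_n$ for a distribution $f$. $\mathcal D$ is the space of smooth compactly supported test functions. Products (as in $3Hp_{ACh}$): the commutative product of distributions $f$ and $g$ exists and equals $h$ on an open interval $(b,c)$ if $\lim_{n\to\infty}\langle f_ng_n,\varphi\rangle=\langle h,\varphi\rangle$ for any $\varphi\in\mathcal D$ with support in $(b,c)$. Composition: $F(f)$ exists and equals the distribution $h$ on $(b,c)$ if $\lim_{n\to\infty}\left[\lim_{m\to\infty}\int_b^cF_n(f_m(\tau))\,\varphi(\tau)\,d\tau\right]=\langle h,\varphi\rangle$ for all $\varphi\in\mathcal D$ with support in $(b,c)$. *)

theory Defs
  imports "HOL-Analysis.Analysis" "HOL-Library.Landau_Symbols"
begin

definition smooth_fun :: "(real \<Rightarrow> real) \<Rightarrow> bool" where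
  "smooth_fun f \<longleftrightarrow> (\<forall>k x. ((deriv ^^ k) f) field_differentiable (at x))"

definition supp :: "(real \<Rightarrow> real) \<Rightarrow> real set" where
  "supp f = closure {x. f x \<noteq> 0}"

definition test_fun :: "(real \<Rightarrow> real) \<Rightarrow> bool" where
  "test_fun \<phi> \<longleftrightarrow> smooth_fun \<phi> \<and> compact (supp \<phi>)"

text \<open>A functional on the test functions is represented by a total HOL function; only its values
  on test functions matter.  Sequential continuity characterises the usual topology of the space
  of test functions for linear functionals.\<close>

type_synonym functional = "(real \<Rightarrow> real) \<Rightarrow> real"

definition is_distribution :: "functional \<Rightarrow> bool" where
  "is_distribution T \<longleftrightarrow>
     (\<forall>\<phi> \<psi> u v. test_fun \<phi> \<longrightarrow> test_fun \<psi> \<longrightarrow>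
        T (\<lambda>x. u * \<phi> x + v * \<psi> x) = u * T \<phi> + v * T \<psi>) \<and>
     (\<forall>\<Phi> K. (\<forall>j. test_fun (\<Phi> j) \<and> supp (\<Phi> j) \<subseteq> K) \<longrightarrow> compact K \<longrightarrow>
        (\<forall>k. uniform_limit UNIV (\<lambda>j. (deriv ^^ k) (\<Phi> j)) (\<lambda>_. 0) sequentially) \<longrightarrow>
        (\<lambda>j. T (\<Phi> j)) \<longlonglongrightarrow> 0)"

definition distr_eq_on :: "real set \<Rightarrow> functional \<Rightarrow> functional \<Rightarrow> bool" where
  "distr_eq_on I S T \<longleftrightarrow> (\<forall>\<phi>. test_fun \<phi> \<longrightarrow> supp \<phi> \<subseteq> I \<longrightarrow> S \<phi> = T \<phi>)"

text \<open>The distribution given by a locally integrable function.\<close>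

definition regular :: "(real \<Rightarrow> real) \<Rightarrow> functional" where
  "regular f = (\<lambda>\<phi>. LBINT t. f t * \<phi> t)"

text \<open>The functional \<open>dirac s\<close> is the distribution \<open>\<delta>(s - t)\<close> in the variable \<open>t\<close>, which is the
  same as \<open>\<delta>(t - s)\<close>.\<close>

definition dirac :: "real \<Rightarrow> functional" where
  "dirac s = (\<lambda>\<phi>. \<phi> s)"

definition distr_deriv :: "functional \<Rightarrow> functional" where
  "distr_deriv T = (\<lambda>\<phi>. - T (deriv \<phi>))"

definition mollifier :: "(real \<Rightarrow> real) \<Rightarrow> bool" where
  "mollifier \<eta> \<longleftrightarrow> smooth_fun \<eta> \<and> (\<forall>x. \<bar>x\<bar> \<ge> 1 \<longrightarrow> \<eta> x = 0) \<and> (\<forall>x. \<eta> x \<ge> 0) \<and>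
     (\<forall>x. \<eta> x = \<eta> (- x)) \<and> (LBINT x:{-1..1}. \<eta> x) = 1"

definition delta_seq :: "(real \<Rightarrow> real) \<Rightarrow> nat \<Rightarrow> real \<Rightarrow> real" where
  "delta_seq \<eta> n x = real n * \<eta> (real n * x)"

text \<open>\<open>mollify \<eta> T n\<close> is the function \<open>T * \<delta>\<^sub>n\<close>.\<close>

definition mollify :: "(real \<Rightarrow> real) \<Rightarrow> functional \<Rightarrow> nat \<Rightarrow> real \<Rightarrow> real" where
  "mollify \<eta> T n x = T (\<lambda>y. delta_seq \<eta> n (x - y))"

definition has_product_on ::
  "(real \<Rightarrow> real) \<Rightarrow> real \<Rightarrow> real \<Rightarrow> functional \<Rightarrow> functional \<Rightarrow> functional \<Rightarrow> bool" where
  "has_product_on \<eta> b c f g h \<longleftrightarrow>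
     is_distribution f \<and> is_distribution g \<and> is_distribution h \<and>
     (\<forall>\<phi>. test_fun \<phi> \<longrightarrow> supp \<phi> \<subseteq> {b<..<c} \<longrightarrow>
        (\<lambda>n. regular (\<lambda>x. mollify \<eta> f n x * mollify \<eta> g n x) \<phi>) \<longlonglongrightarrow> h \<phi>)"

text \<open>In the iterated limit the inner limit is required for all sufficiently large \<open>n\<close>.\<close>

definition has_composition_on ::
  "(real \<Rightarrow> real) \<Rightarrow> real \<Rightarrow> real \<Rightarrow> functional \<Rightarrow> functional \<Rightarrow> functional \<Rightarrow> bool" where
  "has_composition_on \<eta> b c F f h \<longleftrightarrow>
     is_distribution F \<and> is_distribution f \<and> is_distribution h \<and>
     (\<forall>\<phi>. test_fun \<phi> \<longrightarrow> supp \<phi> \<subseteq> {b<..<c} \<longrightarrow>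
        (\<exists>L. (\<forall>\<^sub>F n in sequentially.
                (\<lambda>m. LBINT x:{b<..<c}. mollify \<eta> F n (mollify \<eta> f m x) * \<phi> x) \<longlonglongrightarrow> L n) \<and>
             L \<longlonglongrightarrow> h \<phi>))"

definition locally_integrable_on :: "real \<Rightarrow> real \<Rightarrow> (real \<Rightarrow> real) \<Rightarrow> bool" where
  "locally_integrable_on b c r \<longleftrightarrow>
     (\<forall>u v. b < u \<longrightarrow> v < c \<longrightarrow> set_integrable lborel {u..v} r)"

text \<open>Distributional equality on \<open>(b, c)\<close> for quantities of which only the leading terms at \<open>s\<close> are
  given: the difference of the two sides is a regular distribution whose density is \<open>O(g)\<close> at \<open>s\<close>.
  In particular no term concentrated at \<open>s\<close> may be left over.  The order \<open>g\<close> has to be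
  that of the first terms dropped from the leading-term expressions entering the equation.\<close>

definition distr_eq_upto ::
  "real \<Rightarrow> real \<Rightarrow> real \<Rightarrow> (real \<Rightarrow> real) \<Rightarrow> functional \<Rightarrow> functional \<Rightarrow> bool" where
  "distr_eq_upto b c s g S T \<longleftrightarrow>
     (\<exists>r. locally_integrable_on b c r \<and> r \<in> O[at s](g) \<and>
          distr_eq_on {b<..<c} (\<lambda>\<phi>. S \<phi> - T \<phi>) (regular r))"

end

theory Submission
  imports Defs "HOL-Real_Asymp.Real_Asymp"
begin

text \<open>Every density that occurs is continuous off the singular time \<open>s\<close> and, locally, at most a
  multiple of \<open>1 / sqrt \<bar>s - t\<bar>\<close>.  Regularization preserves such a bound with a constant that does
  not depend on \<open>n\<close>, because the mean of \<open>1 / sqrt \<bar>t\<bar>\<close> over an interval of radius \<open>e\<close> around \<open>v\<close> is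
  at most \<open>4 / sqrt \<bar>v\<bar>\<close>.  Dominated convergence therefore identifies the regular part of all
  products and compositions.  In a product, \<open>\<delta>\<close> meets the odd function \<open>H\<close> and disappears by
  symmetry; in \<open>A / p\<close> the term \<open>\<delta>\<^sub>m\<close> vanishes at every \<open>t \<noteq> s\<close> for large \<open>m\<close> and only increases
  \<open>p\<close>, so it does not affect the iterated limit.  With \<open>k = sqrt (2 A / (3 H\<^sub>S))\<close> the coefficients of
  all leading terms are polynomials in \<open>H\<^sub>S\<close>, \<open>k\<close> and \<open>a\<^sub>S\<close>, and the cosmological equations become
  polynomial identities off \<open>s\<close>.\<close>

text \<open>Two obstacles shape the argument. Since \<open>A / x\<close> is not locally integrable
  at 0, integration against it defines no distribution on the whole line, and \<open>F\<close> is
  known only on test functions supported in \<open>{0<..}\<close>. The composition must therefore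
  keep the window of radius \<open>1 / n\<close> around every value of the regularized pressure away
  from 0, uniformly in the inner index. Moreover, a product of two inverse square roots is not
  locally integrable, so every product pairs a bounded factor with a singular one; hence the two
  classes \<open>locally_bounded\<close> and \<open>sqrt_singular\<close>. The weight
  \<open>4 / 3 * HS\<close> in the pressure is dictated by the jump of \<open>H\<close>, which puts
  \<open>- 2 * HS\<close> into its derivative: \<open>- 3 / 2 * (4 / 3) = - 2\<close>. The equations
  balance exactly in their leading terms. What is left over has the size of the terms dropped from
  the expansions: O(|s - t|) in the Friedmann equation, and O(1) in the other two, where a
  derivative costs one order.\<close>

lemma integral_eq_off_point:
  fixes f g :: "real \<Rightarrow> real"
  assumes "\<And>t. t \<noteq> s \<Longrightarrow> f t = g t"
  shows "integral\<^sup>L lborel f = integral\<^sup>L lborel g"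
  by (rule integral_discrete_difference[where X = "{s}"]) (use assms in auto)

lemma regular_eq_off_point:
  assumes "\<And>t. t \<noteq> s \<Longrightarrow> f t = g t"
  shows "regular f = regular g"
  unfolding regular_def by (intro ext integral_eq_off_point[of s]) (use assms in auto)

text \<open>The majorants below hold only once \<open>n\<close> is large: \<open>delta_seq\<close>
  degenerates to 0 at \<open>n = 0\<close>, and some bounds need \<open>1 / n\<close> small.
  Dropping the first \<open>N\<close> members reduces this to the usual theorem.\<close>

lemma dominated_convergence_eventually:
  fixes g :: "nat \<Rightarrow> real \<Rightarrow> real"
  assumes "f \<in> borel_measurable lborel" "\<And>n. g n \<in> borel_measurable lborel" "integrable lborel w"
    and lim: "\<And>x. x \<noteq> s \<Longrightarrow> (\<lambda>n. g n x) \<longlonglongrightarrow> f x"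
    and bound: "\<forall>\<^sub>F n in sequentially. \<forall>x. x \<noteq> s \<longrightarrow> \<bar>g n x\<bar> \<le> w x"
  shows "(\<lambda>n. integral\<^sup>L lborel (g n)) \<longlonglongrightarrow> integral\<^sup>L lborel f"
proof -
  obtain N where N: "\<And>n x. n \<ge> N \<Longrightarrow> x \<noteq> s \<Longrightarrow> \<bar>g n x\<bar> \<le> w x"
    using bound unfolding eventually_sequentially by blast
  have ae: "AE x in lborel. x \<noteq> s"
    by (rule AE_lborel_singleton)
  have "(\<lambda>n. integral\<^sup>L lborel (g (n + N))) \<longlonglongrightarrow> integral\<^sup>L lborel f"
  proof (rule integral_dominated_convergence[where w = w])
    show "AE x in lborel. (\<lambda>n. g (n + N) x) \<longlonglongrightarrow> f x"
      using ae by eventually_elim (rule LIMSEQ_ignore_initial_segment[OF lim])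
    show "AE x in lborel. norm (g (n + N) x) \<le> w x" for n
      using ae by eventually_elim (use N in auto)
  qed (use assms in auto)
  then show ?thesis
    by (rule LIMSEQ_offset)
qed

text \<open>Measurability of \<open>f\<close> is known only through its truncation to
  \<open>{u..v}\<close>, which suffices because the other factor vanishes elsewhere. The estimate
  serves both the continuity of \<open>regular f\<close> and the size of a mollified
  function.\<close>

lemma integrable_mult_bounded_support:
  fixes f \<psi> :: "real \<Rightarrow> real"
  assumes f: "set_integrable lborel {u..v} f"
    and [measurable]: "\<psi> \<in> borel_measurable borel"
    and bound: "\<And>t. \<bar>\<psi> t\<bar> \<le> M" and zero: "\<And>t. t \<notin> {u..v} \<Longrightarrow> \<psi> t = 0"
  shows "integrable lborel (\<lambda>t. f t * \<psi> t)"
    and "\<bar>LBINT t. f t * \<psi> t\<bar> \<le> M * (LBINT t:{u..v}. \<bar>f t\<bar>)"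
proof -
  let ?g = "\<lambda>t. indicator {u..v} t * f t"
  have g: "integrable lborel ?g"
    using f by (simp add: set_integrable_def)
  then have [measurable]: "?g \<in> borel_measurable lborel"
    by (rule borel_measurable_integrable)
  have eq: "f t * \<psi> t = ?g t * \<psi> t" for t
    using zero[of t] by (auto simp: indicator_def)
  have le: "\<bar>?g t * \<psi> t\<bar> \<le> M * \<bar>?g t\<bar>" for t
    using mult_left_mono[OF bound[of t], of "\<bar>?g t\<bar>"] by (simp add: abs_mult mult.commute)
  have gi: "integrable lborel (\<lambda>t. ?g t * \<psi> t)"
    by (rule Bochner_Integration.integrable_bound[of _ "\<lambda>t. M * \<bar>?g t\<bar>"])
       (use g le in \<open>auto intro!: AE_I2 simp: order_trans[OF le abs_ge_self]\<close>)
  then show "integrable lborel (\<lambda>t. f t * \<psi> t)"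
    by (simp add: eq)
  have "\<bar>LBINT t. ?g t * \<psi> t\<bar> \<le> (LBINT t. \<bar>?g t * \<psi> t\<bar>)"
    by (rule integral_abs_bound)
  also have "\<dots> \<le> (LBINT t. M * \<bar>?g t\<bar>)"
    by (intro integral_mono le) (use gi g in auto)
  also have "\<dots> = M * (LBINT t:{u..v}. \<bar>f t\<bar>)"
    by (simp add: set_lebesgue_integral_def abs_mult)
  finally show "\<bar>LBINT t. f t * \<psi> t\<bar> \<le> M * (LBINT t:{u..v}. \<bar>f t\<bar>)"
    by (simp only: eq)
qed


section \<open>Test functions and distributions\<close>

lemma smooth_fun_has_derivative:
  assumes "smooth_fun f"
  shows "((deriv ^^ k) f has_real_derivative (deriv ^^ Suc k) f x) (at x)"
  using assms by (simp add: smooth_fun_def DERIV_deriv_iff_field_differentiable)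

lemma smooth_fun_isCont: "smooth_fun f \<Longrightarrow> isCont ((deriv ^^ k) f) x"
  by (rule DERIV_isCont[OF smooth_fun_has_derivative])

text \<open>Smoothness concerns the iterates of \<open>deriv\<close>, so a closed form
  \<open>?D k\<close> for every order is exhibited, and induction identifies it with the iterate.
  The next lemma follows the same pattern.\<close>

lemma smooth_fun_affine:
  assumes "smooth_fun f"
  shows "smooth_fun (\<lambda>x. C * f (p * x + q))"
proof -
  let ?D = "\<lambda>k x. C * p ^ k * (deriv ^^ k) f (p * x + q)"
  have der: "(?D k has_real_derivative ?D (Suc k) x) (at x)" for k x
  proof -
    have "((\<lambda>x. (deriv ^^ k) f (p * x + q)) has_real_derivative (deriv ^^ Suc k) f (p * x + q) * p) (at x)"
      by (rule DERIV_chain2[OF smooth_fun_has_derivative[OF assms]]) (auto intro!: derivative_eq_intros)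
    from DERIV_cmult[OF this, of "C * p ^ k"] show ?thesis
      by (simp add: mult_ac)
  qed
  have eq: "(deriv ^^ k) (\<lambda>x. C * f (p * x + q)) = ?D k" for k
  proof (induction k)
    case (Suc k)
    show ?case
      using DERIV_imp_deriv[OF der[of k]] unfolding funpow.simps(2) o_apply Suc.IH by blast
  qed auto
  show ?thesis
    unfolding smooth_fun_def eq field_differentiable_def using der by blast
qed

lemma smooth_fun_lincomb:
  assumes "smooth_fun f" "smooth_fun g"
  shows "smooth_fun (\<lambda>x. u * f x + v * g x)"
proof -
  let ?D = "\<lambda>k x. u * (deriv ^^ k) f x + v * (deriv ^^ k) g x"
  have der: "(?D k has_real_derivative ?D (Suc k) x) (at x)" for k x
    by (intro DERIV_add DERIV_cmult smooth_fun_has_derivative assms)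
  have eq: "(deriv ^^ k) (\<lambda>x. u * f x + v * g x) = ?D k" for k
  proof (induction k)
    case (Suc k)
    show ?case
      using DERIV_imp_deriv[OF der[of k]] unfolding funpow.simps(2) o_apply Suc.IH by blast
  qed auto
  show ?thesis
    unfolding smooth_fun_def eq field_differentiable_def using der by blast
qed

lemma supp_subsetI: "closed S \<Longrightarrow> (\<And>x. x \<notin> S \<Longrightarrow> f x = 0) \<Longrightarrow> supp f \<subseteq> S"
  unfolding supp_def by (rule closure_minimal) auto

lemma eq_0_outside_supp: "x \<notin> supp f \<Longrightarrow> f x = 0"
  unfolding supp_def using closure_subset[of "{x. f x \<noteq> 0}"] by auto

lemma closed_supp: "closed (supp f)"
  by (simp add: supp_def)

lemma test_funI:
  assumes "smooth_fun \<phi>" "\<And>x. x \<notin> {u..v} \<Longrightarrow> \<phi> x = 0"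
  shows "test_fun \<phi>"
proof -
  have "supp \<phi> \<subseteq> {u..v}"
    by (rule supp_subsetI) (use assms in auto)
  then have "compact (supp \<phi>)"
    using closed_supp by (metis compact_Icc compact_Int_closed inf.absorb_iff2)
  with assms show ?thesis by (simp add: test_fun_def)
qed

lemma test_fun_support:
  assumes "test_fun \<phi>"
  obtains R where "R > 0" "\<And>t. \<bar>s - t\<bar> \<ge> R \<Longrightarrow> \<phi> t = 0" "\<And>t. \<bar>s - t\<bar> \<ge> R \<Longrightarrow> deriv \<phi> t = 0"
proof -
  have "bounded (supp \<phi>)"
    using assms by (simp add: test_fun_def compact_imp_bounded)
  then obtain R where R: "\<And>t. t \<in> supp \<phi> \<Longrightarrow> dist s t \<le> R"
    unfolding bounded_any_center[where a = s] by blast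
  have zero: "\<phi> t = 0" if "\<bar>s - t\<bar> > R" for t
    using that R[of t] eq_0_outside_supp[of t \<phi>] by (auto simp: dist_real_def)
  \<comment> \<open>The added 1 places \<open>t\<close> in the open set
    \<open>\<bar>s - t\<bar> > R\<close> where the function vanishes identically, so its derivative
    vanishes at \<open>t\<close> as well. The absolute value makes the radius positive even if
    \<open>R\<close> is negative.\<close>
  show ?thesis
  proof (rule that[of "\<bar>R\<bar> + 1"])
    fix t assume t: "\<bar>s - t\<bar> \<ge> \<bar>R\<bar> + 1"
    then show "\<phi> t = 0" using zero[of t] by auto
    have "open {t. \<bar>s - t\<bar> > R}"
      by (intro open_Collect_less continuous_intros)
    then have "\<forall>\<^sub>F y in nhds t. \<phi> y = 0"
      unfolding eventually_nhds using t zero by (intro exI[of _ "{t. \<bar>s - t\<bar> > R}"]) auto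
    then show "deriv \<phi> t = 0"
      using deriv_cong_ev[of \<phi> "\<lambda>_. 0" t t] by simp
  qed auto
qed

lemma test_fun_lincomb:
  assumes "test_fun \<phi>" "test_fun \<psi>"
  shows "test_fun (\<lambda>x. u * \<phi> x + v * \<psi> x)"
proof -
  obtain R where R: "R > 0" "\<And>t. \<bar>0 - t\<bar> \<ge> R \<Longrightarrow> \<phi> t = 0"
    by (rule test_fun_support[OF assms(1), of 0]) (rule that)
  obtain R' where R': "R' > 0" "\<And>t. \<bar>0 - t\<bar> \<ge> R' \<Longrightarrow> \<psi> t = 0"
    by (rule test_fun_support[OF assms(2), of 0]) (rule that)
  show ?thesis
  proof (rule test_funI)
    show "smooth_fun (\<lambda>x. u * \<phi> x + v * \<psi> x)"
      using assms by (intro smooth_fun_lincomb) (auto simp: test_fun_def)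
    fix x assume "x \<notin> {- max R R' .. max R R'}"
    then show "u * \<phi> x + v * \<psi> x = 0"
      using R(2)[of x] R'(2)[of x] by auto
  qed
qed

lemma test_fun_isCont: "test_fun \<phi> \<Longrightarrow> isCont \<phi> x"
  using smooth_fun_isCont[of \<phi> _ 0] by (simp add: test_fun_def)

lemma test_fun_isCont_deriv: "test_fun \<phi> \<Longrightarrow> isCont (deriv \<phi>) x"
  using smooth_fun_isCont[of \<phi> _ 1] by (simp add: test_fun_def)

lemma test_fun_has_derivative: "test_fun \<phi> \<Longrightarrow> (\<phi> has_real_derivative deriv \<phi> x) (at x)"
  using smooth_fun_has_derivative[of \<phi> 0] by (simp add: test_fun_def)

lemma isCont_bounded_support:
  fixes \<psi> :: "real \<Rightarrow> real"
  assumes "\<And>x. isCont \<psi> x" "\<And>t. t \<notin> {u..v} \<Longrightarrow> \<psi> t = 0"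
  obtains M where "M \<ge> 0" "\<And>t. \<bar>\<psi> t\<bar> \<le> M"
proof -
  have "continuous_on {u..v} \<psi>"
    using assms by (simp add: continuous_at_imp_continuous_on)
  then have "bounded (\<psi> ` {u..v})"
    by (intro compact_imp_bounded compact_continuous_image) auto
  then obtain M where "\<forall>t\<in>{u..v}. \<bar>\<psi> t\<bar> \<le> M"
    unfolding bounded_iff by auto
  then have "\<bar>\<psi> t\<bar> \<le> \<bar>M\<bar>" for t
    using assms(2)[of t] by (cases "t \<in> {u..v}") force+
  then show ?thesis
    using that[of "\<bar>M\<bar>"] by auto
qed

lemma test_fun_bounded:
  assumes "test_fun \<phi>"
  obtains M where "M \<ge> 0" "\<And>t. \<bar>\<phi> t\<bar> \<le> M"
proof -
  obtain R where R: "\<And>t. \<bar>0 - t\<bar> \<ge> R \<Longrightarrow> \<phi> t = 0"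
    by (rule test_fun_support[OF assms, of 0]) (rule that)
  have "\<phi> t = 0" if "t \<notin> {-R..R}" for t
    using that R[of t] by auto
  then show ?thesis
    using isCont_bounded_support[OF test_fun_isCont[OF assms]] that by metis
qed

lemma test_fun_measurable: "test_fun \<phi> \<Longrightarrow> \<phi> \<in> borel_measurable borel"
  by (intro borel_measurable_continuous_onI continuous_at_imp_continuous_on) (simp add: test_fun_isCont)

lemma integrable_mult_test_fun:
  assumes f: "\<And>u v. set_integrable lborel {u..v} f" and \<phi>: "test_fun \<phi>"
  shows "integrable lborel (\<lambda>t. f t * \<phi> t)" "integrable lborel (\<lambda>t. f t * deriv \<phi> t)"
proof -
  obtain R where R: "\<And>t. \<bar>0 - t\<bar> \<ge> R \<Longrightarrow> \<phi> t = 0" "\<And>t. \<bar>0 - t\<bar> \<ge> R \<Longrightarrow> deriv \<phi> t = 0"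
    by (rule test_fun_support[OF \<phi>, of 0]) (rule that)
  have zero: "\<phi> t = 0" "deriv \<phi> t = 0" if "t \<notin> {-R..R}" for t
    using that R[of t] by auto
  obtain M where "\<And>t. \<bar>\<phi> t\<bar> \<le> M"
    by (rule test_fun_bounded[OF \<phi>]) (rule that)
  then show "integrable lborel (\<lambda>t. f t * \<phi> t)"
    by (rule integrable_mult_bounded_support(1)[OF f test_fun_measurable[OF \<phi>] _ zero(1)])
  obtain M where M: "\<And>t. \<bar>deriv \<phi> t\<bar> \<le> M"
    by (rule isCont_bounded_support[of "deriv \<phi>" "-R" R, OF test_fun_isCont_deriv[OF \<phi>]]) (erule zero(2), rule that)
  have "deriv \<phi> \<in> borel_measurable borel"
    by (intro borel_measurable_continuous_onI continuous_at_imp_continuous_on)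
       (simp add: test_fun_isCont_deriv[OF \<phi>])
  then show "integrable lborel (\<lambda>t. f t * deriv \<phi> t)"
    by (rule integrable_mult_bounded_support(1)[OF f _ M zero(2)])
qed

text \<open>The functional has order zero: on test functions supported in \<open>K\<close> it is
  bounded by the supremum norm times the integral of \<open>\<bar>f\<bar>\<close> over an interval
  containing \<open>K\<close>.\<close>

lemma is_distribution_regular:
  assumes f: "\<And>u v. set_integrable lborel {u..v} f"
  shows "is_distribution (regular f)"
  unfolding is_distribution_def
proof (intro conjI allI impI)
  fix \<phi> \<psi> u v assume t: "test_fun \<phi>" "test_fun \<psi>"
  have "regular f (\<lambda>x. u * \<phi> x + v * \<psi> x) = (LBINT t. u * (f t * \<phi> t) + v * (f t * \<psi> t))"
    unfolding regular_def by (simp add: algebra_simps)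
  also have "\<dots> = u * regular f \<phi> + v * regular f \<psi>"
    unfolding regular_def using integrable_mult_test_fun(1)[OF f] t by simp
  finally show "regular f (\<lambda>x. u * \<phi> x + v * \<psi> x) = u * regular f \<phi> + v * regular f \<psi>" .
next
  fix \<Phi> :: "nat \<Rightarrow> real \<Rightarrow> real" and K
  assume \<Phi>: "\<forall>j. test_fun (\<Phi> j) \<and> supp (\<Phi> j) \<subseteq> K" and K: "compact K"
    and lim: "\<forall>k. uniform_limit UNIV (\<lambda>j. (deriv ^^ k) (\<Phi> j)) (\<lambda>_. 0) sequentially"
  obtain R where "\<forall>x\<in>K. \<bar>x\<bar> \<le> R"
    using compact_imp_bounded[OF K] unfolding bounded_iff by auto
  then have R: "K \<subseteq> {-R..R}"
    by (auto simp: abs_le_iff minus_le_iff)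
  define C where "C = (LBINT t:{-R..R}. \<bar>f t\<bar>)"
  have C: "C \<ge> 0"
    unfolding C_def by (simp add: set_lebesgue_integral_def integral_nonneg)
  have zero: "\<Phi> j t = 0" if "t \<notin> {-R..R}" for j t
    using that \<Phi> R eq_0_outside_supp[of t "\<Phi> j"] by blast
  show "(\<lambda>j. regular f (\<Phi> j)) \<longlonglongrightarrow> 0"
  proof (rule tendstoI)
    fix e :: real assume e: "e > 0"
    have "uniform_limit UNIV \<Phi> (\<lambda>_. 0) sequentially"
      using lim[rule_format, of 0] by simp
    then have "\<forall>\<^sub>F j in sequentially. \<forall>t\<in>UNIV. dist (\<Phi> j t) 0 < e / (C + 1)"
      by (rule uniform_limitD) (use C e in auto)
    then show "\<forall>\<^sub>F j in sequentially. dist (regular f (\<Phi> j)) 0 < e"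
    proof eventually_elim
      case (elim j)
      then have le: "\<bar>\<Phi> j t\<bar> \<le> e / (C + 1)" for t
        by (simp add: less_imp_le)
      have "\<Phi> j \<in> borel_measurable borel"
        using \<Phi> by (simp add: test_fun_measurable)
      from integrable_mult_bounded_support(2)[OF f this le zero]
      have "\<bar>regular f (\<Phi> j)\<bar> \<le> e / (C + 1) * C"
        by (simp only: regular_def C_def)
      also have "\<dots> < e"
        using C e by (simp add: field_simps)
      finally show ?case by simp
    qed
  qed
qed

lemma is_distribution_dirac: "is_distribution (dirac s)"
  unfolding is_distribution_def dirac_def
proof (intro conjI allI impI)
  fix \<Phi> :: "nat \<Rightarrow> real \<Rightarrow> real"
  assume lim: "\<forall>k. uniform_limit UNIV (\<lambda>j. (deriv ^^ k) (\<Phi> j)) (\<lambda>_. 0) sequentially"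
  show "(\<lambda>j. \<Phi> j s) \<longlonglongrightarrow> 0"
    using tendsto_uniform_limitI[OF lim[rule_format, of 0], of s] by simp
qed auto

lemma is_distribution_lincomb:
  assumes S: "is_distribution S" and T: "is_distribution T"
  shows "is_distribution (\<lambda>\<phi>. u * S \<phi> + v * T \<phi>)"
  unfolding is_distribution_def
proof (intro conjI allI impI)
  fix \<phi> \<psi> x y assume "test_fun \<phi>" "test_fun \<psi>"
  then have "S (\<lambda>t. x * \<phi> t + y * \<psi> t) = x * S \<phi> + y * S \<psi>"
    "T (\<lambda>t. x * \<phi> t + y * \<psi> t) = x * T \<phi> + y * T \<psi>"
    using assms by (auto simp: is_distribution_def)
  then show "u * S (\<lambda>t. x * \<phi> t + y * \<psi> t) + v * T (\<lambda>t. x * \<phi> t + y * \<psi> t)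
      = x * (u * S \<phi> + v * T \<phi>) + y * (u * S \<psi> + v * T \<psi>)"
    by (simp add: algebra_simps)
next
  fix \<Phi> :: "nat \<Rightarrow> real \<Rightarrow> real" and K
  assume h: "\<forall>j. test_fun (\<Phi> j) \<and> supp (\<Phi> j) \<subseteq> K" "compact K"
    "\<forall>k. uniform_limit UNIV (\<lambda>j. (deriv ^^ k) (\<Phi> j)) (\<lambda>_. 0) sequentially"
  have "(\<lambda>j. S (\<Phi> j)) \<longlonglongrightarrow> 0" "(\<lambda>j. T (\<Phi> j)) \<longlonglongrightarrow> 0"
    using S T h unfolding is_distribution_def by blast+
  then have "(\<lambda>j. u * S (\<Phi> j) + v * T (\<Phi> j)) \<longlonglongrightarrow> u * 0 + v * 0"
    by (intro tendsto_intros)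
  then show "(\<lambda>j. u * S (\<Phi> j) + v * T (\<Phi> j)) \<longlonglongrightarrow> 0" by simp
qed

text \<open>Functionals are total, with arbitrary values off the test functions, so they can be
  compared only there. The combinations in the linearity clause are again test functions.\<close>

lemma is_distribution_cong:
  assumes "\<And>\<phi>. test_fun \<phi> \<Longrightarrow> S \<phi> = T \<phi>" and T: "is_distribution T"
  shows "is_distribution S"
  unfolding is_distribution_def
proof (intro conjI allI impI)
  fix \<phi> \<psi> x y assume "test_fun \<phi>" "test_fun \<psi>"
  then show "S (\<lambda>t. x * \<phi> t + y * \<psi> t) = x * S \<phi> + y * S \<psi>"
    using T by (simp add: assms(1) test_fun_lincomb is_distribution_def)
next
  fix \<Phi> :: "nat \<Rightarrow> real \<Rightarrow> real" and K
  assume h: "\<forall>j. test_fun (\<Phi> j) \<and> supp (\<Phi> j) \<subseteq> K" "compact K"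
    "\<forall>k. uniform_limit UNIV (\<lambda>j. (deriv ^^ k) (\<Phi> j)) (\<lambda>_. 0) sequentially"
  then have "(\<lambda>j. T (\<Phi> j)) \<longlonglongrightarrow> 0"
    using T unfolding is_distribution_def by blast
  then show "(\<lambda>j. S (\<Phi> j)) \<longlonglongrightarrow> 0"
    using h(1) by (simp add: assms(1))
qed


section \<open>Inverse square root singularities\<close>

text \<open>In HOL \<open>sqrt\<close> is odd, \<open>sqrt (- x) = - sqrt x\<close>. Hence
  \<open>- 2 * sqrt (s - t)\<close> is a single continuous antiderivative of
  \<open>1 / sqrt \<bar>s - t\<bar>\<close> on the whole line, across the singularity.\<close>

lemma DERIV_sqrt_abs: "x \<noteq> 0 \<Longrightarrow> (sqrt has_real_derivative 1 / (2 * sqrt \<bar>x\<bar>)) (at x)"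
  by (rule DERIV_real_sqrt_generic) (auto simp: real_sqrt_minus field_simps)

lemma has_integral_inverse_sqrt:
  assumes "u \<le> v"
  shows "((\<lambda>t. 1 / sqrt \<bar>s - t\<bar>) has_integral 2 * sqrt (s - u) - 2 * sqrt (s - v)) {u..v}"
proof -
  have "((\<lambda>t. 1 / sqrt \<bar>s - t\<bar>) has_integral - 2 * sqrt (s - v) - - 2 * sqrt (s - u)) {u..v}"
  proof (rule fundamental_theorem_of_calculus_interior_strong[where S = "{s}"])
    fix t assume "t \<in> {u<..<v} - {s}"
    then have "s - t \<noteq> 0" by auto
    then have "((\<lambda>t. sqrt (s - t)) has_real_derivative 1 / (2 * sqrt \<bar>s - t\<bar>) * (- 1)) (at t)"
      by (intro DERIV_chain2[OF DERIV_sqrt_abs]) (auto intro!: derivative_eq_intros)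
    from DERIV_cmult[OF this, of "- 2"]
    show "((\<lambda>t. - 2 * sqrt (s - t)) has_vector_derivative 1 / sqrt \<bar>s - t\<bar>) (at t)"
      by (simp add: has_real_derivative_iff_has_vector_derivative)
  qed (use assms in \<open>auto intro!: continuous_intros\<close>)
  then show ?thesis by simp
qed

lemma inverse_sqrt_integral:
  fixes u v s :: real
  shows "set_integrable lborel {u..v} (\<lambda>t. 1 / sqrt \<bar>s - t\<bar>)"
    and "u \<le> v \<Longrightarrow> (LBINT t:{u..v}. 1 / sqrt \<bar>s - t\<bar>) = 2 * sqrt (s - u) - 2 * sqrt (s - v)"
proof -
  have int: "set_integrable lborel {u..v} (\<lambda>t. 1 / sqrt \<bar>s - t\<bar>)" if "u \<le> v"
  proof -
    have "(\<lambda>t. 1 / sqrt \<bar>s - t\<bar>) absolutely_integrable_on {u..v}"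
      by (rule nonnegative_absolutely_integrable_1)
         (use has_integral_inverse_sqrt[OF that, of s] in \<open>auto simp: integrable_on_def\<close>)
    then show ?thesis
      unfolding set_integrable_def by (subst (asm) integrable_completion) auto
  qed
  then show "set_integrable lborel {u..v} (\<lambda>t. 1 / sqrt \<bar>s - t\<bar>)"
    by (cases "u \<le> v") (auto simp: set_integrable_def)
  assume uv: "u \<le> v"
  show "(LBINT t:{u..v}. 1 / sqrt \<bar>s - t\<bar>) = 2 * sqrt (s - u) - 2 * sqrt (s - v)"
    using set_borel_integral_eq_integral(2)[OF int[OF uv]] has_integral_inverse_sqrt[OF uv, of s]
    by (simp add: integral_unique)
qed

text \<open>The first factor is the integral of \<open>1 / sqrt \<bar>t\<bar>\<close> over the
  interval of radius \<open>e\<close> around \<open>v\<close>. For \<open>v \<ge> e\<close>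
  rationalizing the difference gives \<open>4 * e\<close>; for \<open>0 < v < e\<close> all roots
  are comparable to \<open>sqrt e\<close>, which gives \<open>6 * e\<close>; negative
  \<open>v\<close> follows by oddness of \<open>sqrt\<close>. The constant 8 has some slack.\<close>

lemma sqrt_increment_bound:
  fixes v e :: real
  assumes e: "e > 0" and v: "v \<noteq> 0"
  shows "(2 * sqrt (v + e) - 2 * sqrt (v - e)) * sqrt \<bar>v\<bar> \<le> 8 * e"
proof -
  have pos: "(2 * sqrt (v + e) - 2 * sqrt (v - e)) * sqrt v \<le> 8 * e" if "v > 0" for v
  proof (cases "v \<ge> e")
    case True
    have "(sqrt (v + e) - sqrt (v - e)) * sqrt v \<le> (sqrt (v + e) - sqrt (v - e)) * (sqrt (v + e) + sqrt (v - e))"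
    proof (rule mult_left_mono)
      have "sqrt v \<le> sqrt (v + e)" "0 \<le> sqrt (v - e)" using e True by auto
      then show "sqrt v \<le> sqrt (v + e) + sqrt (v - e)" by linarith
    qed (use e in auto)
    also have "\<dots> = (sqrt (v + e))\<^sup>2 - (sqrt (v - e))\<^sup>2"
      by (simp add: power2_eq_square algebra_simps)
    also have "\<dots> = 2 * e"
      using True e that by simp
    finally show ?thesis using e by (simp add: algebra_simps)
  next
    case False
    have "sqrt (v + e) \<le> sqrt (4 * e)"
      using False e by simp
    then have 1: "sqrt (v + e) \<le> 2 * sqrt e"
      by (simp add: real_sqrt_mult)
    have "sqrt (e - v) \<le> sqrt e"
      using that by simp
    moreover have "sqrt (v - e) = - sqrt (e - v)"
      using real_sqrt_minus[of "e - v"] by simp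
    ultimately have 2: "2 * sqrt (v + e) - 2 * sqrt (v - e) \<le> 6 * sqrt e"
      using 1 by linarith
    have "(2 * sqrt (v + e) - 2 * sqrt (v - e)) * sqrt v \<le> (6 * sqrt e) * sqrt e"
      by (rule mult_mono) (use 2 False that e in auto)
    also have "\<dots> = 6 * e" using e by simp
    finally show ?thesis using e by linarith
  qed
  show ?thesis
  proof (cases "v > 0")
    case True
    then show ?thesis using pos by simp
  next
    case False
    have "sqrt (v + e) = - sqrt (- v - e)" "sqrt (v - e) = - sqrt (- v + e)"
      using real_sqrt_minus[of "- v - e"] real_sqrt_minus[of "- v + e"] by (simp_all add: algebra_simps)
    then show ?thesis using pos[of "- v"] False v by simp
  qed
qed

text \<open>The bound is a product rather than a quotient, so that it leaves \<open>f s\<close>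
  arbitrary. Continuity off \<open>s\<close> supplies measurability and pointwise convergence of the
  mollified functions.\<close>

definition sqrt_singular :: "real \<Rightarrow> (real \<Rightarrow> real) \<Rightarrow> bool" where
  "sqrt_singular s f \<longleftrightarrow>
     (\<forall>t. t \<noteq> s \<longrightarrow> isCont f t) \<and> (\<forall>R. \<exists>K. \<forall>t. \<bar>s - t\<bar> \<le> R \<longrightarrow> \<bar>f t\<bar> * sqrt \<bar>s - t\<bar> \<le> K)"

definition locally_bounded :: "real \<Rightarrow> (real \<Rightarrow> real) \<Rightarrow> bool" where
  "locally_bounded s f \<longleftrightarrow>
     (\<forall>t. t \<noteq> s \<longrightarrow> isCont f t) \<and> (\<forall>R. \<exists>K. \<forall>t. \<bar>s - t\<bar> \<le> R \<longrightarrow> \<bar>f t\<bar> \<le> K)"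

lemma sqrt_singularD:
  assumes "sqrt_singular s f"
  shows "t \<noteq> s \<Longrightarrow> isCont f t"
    and "\<exists>K\<ge>0. \<forall>t. \<bar>s - t\<bar> \<le> R \<longrightarrow> \<bar>f t\<bar> * sqrt \<bar>s - t\<bar> \<le> K"
proof -
  show "t \<noteq> s \<Longrightarrow> isCont f t"
    using assms by (simp add: sqrt_singular_def)
  obtain K where "\<forall>t. \<bar>s - t\<bar> \<le> R \<longrightarrow> \<bar>f t\<bar> * sqrt \<bar>s - t\<bar> \<le> K"
    using assms unfolding sqrt_singular_def by blast
  then show "\<exists>K\<ge>0. \<forall>t. \<bar>s - t\<bar> \<le> R \<longrightarrow> \<bar>f t\<bar> * sqrt \<bar>s - t\<bar> \<le> K"
    by (intro exI[of _ "max K 0"]) (auto simp: le_max_iff_disj)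
qed

lemma locally_boundedD:
  assumes "locally_bounded s f"
  shows "t \<noteq> s \<Longrightarrow> isCont f t"
    and "\<exists>K\<ge>0. \<forall>t. \<bar>s - t\<bar> \<le> R \<longrightarrow> \<bar>f t\<bar> \<le> K"
proof -
  show "t \<noteq> s \<Longrightarrow> isCont f t"
    using assms by (simp add: locally_bounded_def)
  obtain K where "\<forall>t. \<bar>s - t\<bar> \<le> R \<longrightarrow> \<bar>f t\<bar> \<le> K"
    using assms unfolding locally_bounded_def by blast
  then show "\<exists>K\<ge>0. \<forall>t. \<bar>s - t\<bar> \<le> R \<longrightarrow> \<bar>f t\<bar> \<le> K"
    by (intro exI[of _ "max K 0"]) (auto simp: le_max_iff_disj)
qed

lemma locally_bounded_mult_singular:
  assumes f: "locally_bounded s f" and g: "sqrt_singular s g"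
  shows "sqrt_singular s (\<lambda>t. f t * g t)"
  unfolding sqrt_singular_def
proof (intro conjI allI impI)
  fix t assume "t \<noteq> s"
  then show "isCont (\<lambda>t. f t * g t) t"
    using locally_boundedD(1)[OF f] sqrt_singularD(1)[OF g] by (intro continuous_intros) auto
next
  fix R
  obtain K where K: "K \<ge> 0" "\<And>t. \<bar>s - t\<bar> \<le> R \<Longrightarrow> \<bar>f t\<bar> \<le> K"
    using locally_boundedD(2)[OF f, of R] by blast
  obtain L where L: "L \<ge> 0" "\<And>t. \<bar>s - t\<bar> \<le> R \<Longrightarrow> \<bar>g t\<bar> * sqrt \<bar>s - t\<bar> \<le> L"
    using sqrt_singularD(2)[OF g, of R] by blast
  have "\<bar>f t * g t\<bar> * sqrt \<bar>s - t\<bar> \<le> K * L" if "\<bar>s - t\<bar> \<le> R" for t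
    using mult_mono[OF K(2)[OF that] L(2)[OF that]] K(1) by (simp add: abs_mult mult.assoc)
  then show "\<exists>K. \<forall>t. \<bar>s - t\<bar> \<le> R \<longrightarrow> \<bar>f t * g t\<bar> * sqrt \<bar>s - t\<bar> \<le> K"
    by blast
qed

lemma locally_bounded_imp_singular:
  assumes "locally_bounded s f"
  shows "sqrt_singular s f"
proof -
  have "sqrt_singular s (\<lambda>_. 1)"
    unfolding sqrt_singular_def by (auto intro: real_sqrt_le_mono)
  from locally_bounded_mult_singular[OF assms this] show ?thesis by simp
qed

lemma isCont_imp_locally_bounded:
  fixes f :: "real \<Rightarrow> real"
  assumes "\<And>t. isCont f t"
  shows "locally_bounded s f"
  unfolding locally_bounded_def
proof (intro conjI allI impI)
  fix R
  have "bounded (f ` {s-R..s+R})"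
    using assms by (intro compact_imp_bounded compact_continuous_image)
      (auto simp: continuous_at_imp_continuous_on)
  then obtain K where "\<forall>x\<in>{s-R..s+R}. \<bar>f x\<bar> \<le> K"
    unfolding bounded_iff by auto
  moreover have "t \<in> {s-R..s+R}" if "\<bar>s - t\<bar> \<le> R" for t
    using that by auto
  ultimately show "\<exists>K. \<forall>t. \<bar>s - t\<bar> \<le> R \<longrightarrow> \<bar>f t\<bar> \<le> K"
    by blast
qed (use assms in auto)

lemma sqrt_singular_add:
  assumes f: "sqrt_singular s f" and g: "sqrt_singular s g"
  shows "sqrt_singular s (\<lambda>t. f t + g t)"
  unfolding sqrt_singular_def
proof (intro conjI allI impI)
  fix t assume "t \<noteq> s"
  then show "isCont (\<lambda>t. f t + g t) t"
    using sqrt_singularD(1)[OF f] sqrt_singularD(1)[OF g] by (intro continuous_intros) auto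
next
  fix R
  obtain K where K: "\<And>t. \<bar>s - t\<bar> \<le> R \<Longrightarrow> \<bar>f t\<bar> * sqrt \<bar>s - t\<bar> \<le> K"
    using sqrt_singularD(2)[OF f, of R] by blast
  obtain L where L: "\<And>t. \<bar>s - t\<bar> \<le> R \<Longrightarrow> \<bar>g t\<bar> * sqrt \<bar>s - t\<bar> \<le> L"
    using sqrt_singularD(2)[OF g, of R] by blast
  have "\<bar>f t + g t\<bar> * sqrt \<bar>s - t\<bar> \<le> K + L" if "\<bar>s - t\<bar> \<le> R" for t
  proof -
    have "\<bar>f t + g t\<bar> * sqrt \<bar>s - t\<bar> \<le> (\<bar>f t\<bar> + \<bar>g t\<bar>) * sqrt \<bar>s - t\<bar>"
      by (intro mult_right_mono) auto
    then show ?thesis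
      using K[OF that] L[OF that] by (simp add: algebra_simps)
  qed
  then show "\<exists>K. \<forall>t. \<bar>s - t\<bar> \<le> R \<longrightarrow> \<bar>f t + g t\<bar> * sqrt \<bar>s - t\<bar> \<le> K"
    by blast
qed

lemma locally_bounded_add:
  assumes f: "locally_bounded s f" and g: "locally_bounded s g"
  shows "locally_bounded s (\<lambda>t. f t + g t)"
  unfolding locally_bounded_def
proof (intro conjI allI impI)
  fix t assume "t \<noteq> s"
  then show "isCont (\<lambda>t. f t + g t) t"
    using locally_boundedD(1)[OF f] locally_boundedD(1)[OF g] by (intro continuous_intros) auto
next
  fix R
  obtain K where K: "\<And>t. \<bar>s - t\<bar> \<le> R \<Longrightarrow> \<bar>f t\<bar> \<le> K"
    using locally_boundedD(2)[OF f, of R] by blast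
  obtain L where L: "\<And>t. \<bar>s - t\<bar> \<le> R \<Longrightarrow> \<bar>g t\<bar> \<le> L"
    using locally_boundedD(2)[OF g, of R] by blast
  have "\<bar>f t + g t\<bar> \<le> K + L" if "\<bar>s - t\<bar> \<le> R" for t
    using K[OF that] L[OF that] by linarith
  then show "\<exists>K. \<forall>t. \<bar>s - t\<bar> \<le> R \<longrightarrow> \<bar>f t + g t\<bar> \<le> K"
    by blast
qed

lemma locally_bounded_mult:
  assumes f: "locally_bounded s f" and g: "locally_bounded s g"
  shows "locally_bounded s (\<lambda>t. f t * g t)"
  unfolding locally_bounded_def
proof (intro conjI allI impI)
  fix t assume "t \<noteq> s"
  then show "isCont (\<lambda>t. f t * g t) t"
    using locally_boundedD(1)[OF f] locally_boundedD(1)[OF g] by (intro continuous_intros) auto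
next
  fix R
  obtain K where K: "K \<ge> 0" "\<And>t. \<bar>s - t\<bar> \<le> R \<Longrightarrow> \<bar>f t\<bar> \<le> K"
    using locally_boundedD(2)[OF f, of R] by blast
  obtain L where L: "\<And>t. \<bar>s - t\<bar> \<le> R \<Longrightarrow> \<bar>g t\<bar> \<le> L"
    using locally_boundedD(2)[OF g, of R] by blast
  have "\<bar>f t * g t\<bar> \<le> K * L" if "\<bar>s - t\<bar> \<le> R" for t
    using mult_mono[OF K(2)[OF that] L[OF that]] K(1) by (simp add: abs_mult)
  then show "\<exists>K. \<forall>t. \<bar>s - t\<bar> \<le> R \<longrightarrow> \<bar>f t * g t\<bar> \<le> K"
    by blast
qed

lemma locally_bounded_sgn: "locally_bounded s (\<lambda>t. sgn (s - t))"
  unfolding locally_bounded_def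
proof (intro conjI allI impI)
  fix t assume "t \<noteq> s"
  then show "isCont (\<lambda>t. sgn (s - t)) t"
    by (intro isCont_sgn continuous_intros) auto
next
  show "\<exists>K. \<forall>t. \<bar>s - t\<bar> \<le> R \<longrightarrow> \<bar>sgn (s - t)\<bar> \<le> K" for R
    by (intro exI[of _ 1]) (auto simp: sgn_real_def)
qed

lemma sqrt_singular_inverse_sqrt: "sqrt_singular s (\<lambda>t. 1 / sqrt \<bar>s - t\<bar>)"
  unfolding sqrt_singular_def
proof (intro conjI allI impI)
  show "\<exists>K. \<forall>t. \<bar>s - t\<bar> \<le> R \<longrightarrow> \<bar>1 / sqrt \<bar>s - t\<bar>\<bar> * sqrt \<bar>s - t\<bar> \<le> K" for R
    by (intro exI[of _ 1]) auto
qed (auto intro!: continuous_intros)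

lemma borel_measurable_isCont_off_point:
  fixes f :: "real \<Rightarrow> real"
  assumes "\<And>t. t \<noteq> s \<Longrightarrow> isCont f t"
  shows "f \<in> borel_measurable borel"
  by (rule borel_measurable_continuous_countable_exceptions[of "{s}"])
     (use assms in \<open>auto intro!: continuous_at_imp_continuous_on\<close>)

lemma sqrt_singular_measurable: "sqrt_singular s f \<Longrightarrow> f \<in> borel_measurable borel"
  by (rule borel_measurable_isCont_off_point) (rule sqrt_singularD(1))

lemma sqrt_singular_integral_bound:
  assumes f: "sqrt_singular s f" and uv: "u \<le> v"
    and K: "\<And>t. t \<in> {u..v} \<Longrightarrow> \<bar>f t\<bar> * sqrt \<bar>s - t\<bar> \<le> K"
  shows "set_integrable lborel {u..v} f"
    and "(LBINT t:{u..v}. \<bar>f t\<bar>) \<le> K * (2 * sqrt (s - u) - 2 * sqrt (s - v))"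
proof -
  have [measurable]: "f \<in> borel_measurable borel"
    by (rule sqrt_singular_measurable[OF f])
  have w: "integrable lborel (\<lambda>t. K * (indicator {u..v} t * (1 / sqrt \<bar>s - t\<bar>)))"
    by (rule integrable_mult_right) (use inverse_sqrt_integral(1)[of u v s] in \<open>simp add: set_integrable_def\<close>)
  \<comment> \<open>The inequality can fail at \<open>s\<close>: division by zero makes the majorant
    0 there, while \<open>f s\<close> is arbitrary.\<close>
  have ae: "AE t in lborel. indicator {u..v} t * \<bar>f t\<bar> \<le> K * (indicator {u..v} t * (1 / sqrt \<bar>s - t\<bar>))"
    using AE_lborel_singleton[of s]
  proof eventually_elim
    case (elim t)
    then show ?case
      using K[of t] by (auto simp: indicator_def field_simps)
  qed
  have int: "integrable lborel (\<lambda>t. indicator {u..v} t * f t)"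
  proof (rule Bochner_Integration.integrable_bound[OF w])
    show "AE t in lborel. norm (indicator {u..v} t * f t)
        \<le> norm (K * (indicator {u..v} t * (1 / sqrt \<bar>s - t\<bar>)))"
      using ae
    proof eventually_elim
      case (elim t)
      have "norm (indicator {u..v} t * f t) = indicator {u..v} t * \<bar>f t\<bar>"
        by (simp add: abs_mult)
      also note elim
      also have "K * (indicator {u..v} t * (1 / sqrt \<bar>s - t\<bar>))
          \<le> norm (K * (indicator {u..v} t * (1 / sqrt \<bar>s - t\<bar>)))"
        unfolding real_norm_def by (rule abs_ge_self)
      finally show ?case .
    qed
  qed simp
  then show "set_integrable lborel {u..v} f"
    by (simp add: set_integrable_def)
  have "(LBINT t:{u..v}. \<bar>f t\<bar>) \<le> (LBINT t. K * (indicator {u..v} t * (1 / sqrt \<bar>s - t\<bar>)))"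
    unfolding set_lebesgue_integral_def
    using ae integrable_abs[OF int] w by (intro integral_mono_AE) (auto simp: abs_mult)
  also have "\<dots> = K * (2 * sqrt (s - u) - 2 * sqrt (s - v))"
    unfolding integral_mult_right_zero
    using inverse_sqrt_integral(2)[OF uv, of s] by (simp add: set_lebesgue_integral_def)
  finally show "(LBINT t:{u..v}. \<bar>f t\<bar>) \<le> K * (2 * sqrt (s - u) - 2 * sqrt (s - v))" .
qed

lemma sqrt_singular_integrable:
  assumes f: "sqrt_singular s f"
  shows "set_integrable lborel {u..v} f"
proof (cases "u \<le> v")
  case True
  obtain K where K: "\<And>t. \<bar>s - t\<bar> \<le> \<bar>s - u\<bar> + \<bar>s - v\<bar> \<Longrightarrow> \<bar>f t\<bar> * sqrt \<bar>s - t\<bar> \<le> K"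
    using sqrt_singularD(2)[OF f] by blast
  have "\<bar>f t\<bar> * sqrt \<bar>s - t\<bar> \<le> K" if "t \<in> {u..v}" for t
    by (rule K) (use that in auto)
  then show ?thesis
    by (rule sqrt_singular_integral_bound(1)[OF f True])
qed (simp add: set_integrable_def)

section \<open>Integration by parts\<close>

text \<open>Passes from the gauge integral over an interval, as delivered by the fundamental theorem
  of calculus, to the Lebesgue integral over the line in which distributions are expressed.\<close>

lemma lborel_integral_eq_of_support:
  fixes h :: "real \<Rightarrow> real"
  assumes "(h has_integral I) {u..v}" "integrable lborel h" "\<And>t. t \<notin> {u..v} \<Longrightarrow> h t = 0"
  shows "integral\<^sup>L lborel h = I"
proof -
  have "(h has_integral I) UNIV"
    by (rule has_integral_on_superset[OF assms(1)]) (use assms(3) in auto)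
  then show ?thesis
    using has_integral_integral_lborel[OF assms(2)] has_integral_unique by blast
qed

text \<open>Continuity at \<open>s\<close> excludes a jump and with it a delta-term. The fundamental
  theorem applied to \<open>f * \<phi>\<close> tolerates one exceptional point, and the boundary
  terms vanish by compact support.\<close>

lemma distr_deriv_regular:
  assumes cont: "\<And>t. isCont f t" and der: "\<And>t. t \<noteq> s \<Longrightarrow> (f has_real_derivative f' t) (at t)"
    and f': "\<And>u v. set_integrable lborel {u..v} f'" and \<phi>: "test_fun \<phi>"
  shows "distr_deriv (regular f) \<phi> = regular f' \<phi>"
proof -
  have f: "set_integrable lborel {u..v} f" for u v
    by (intro borel_integrable_atLeastAtMost') (use cont in \<open>auto intro!: continuous_at_imp_continuous_on\<close>)
  obtain R where R: "R > 0" "\<And>t. \<bar>s - t\<bar> \<ge> R \<Longrightarrow> \<phi> t = 0" "\<And>t. \<bar>s - t\<bar> \<ge> R \<Longrightarrow> deriv \<phi> t = 0"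
    by (rule test_fun_support[OF \<phi>, of s]) (rule that)
  let ?h = "\<lambda>t. f' t * \<phi> t + f t * deriv \<phi> t"
  note int = integrable_mult_test_fun[OF f \<phi>] integrable_mult_test_fun[OF f' \<phi>]
  have "(?h has_integral f (s + R) * \<phi> (s + R) - f (s - R) * \<phi> (s - R)) {s - R..s + R}"
  proof (rule fundamental_theorem_of_calculus_interior_strong[where S = "{s}"])
    show "continuous_on {s - R..s + R} (\<lambda>t. f t * \<phi> t)"
      using cont test_fun_isCont[OF \<phi>] by (auto intro!: continuous_at_imp_continuous_on continuous_intros)
    fix t assume "t \<in> {s - R<..<s + R} - {s}"
    then have "((\<lambda>t. f t * \<phi> t) has_real_derivative ?h t) (at t)"
      using DERIV_mult[OF der test_fun_has_derivative[OF \<phi>], of t] by (simp add: mult.commute)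
    then show "((\<lambda>t. f t * \<phi> t) has_vector_derivative ?h t) (at t)"
      by (simp add: has_real_derivative_iff_has_vector_derivative)
  qed (use R in auto)
  then have "(?h has_integral 0) {s - R..s + R}"
    using R by simp
  then have "integral\<^sup>L lborel ?h = 0"
    by (rule lborel_integral_eq_of_support) (use int R in \<open>auto simp: abs_if\<close>)
  then show ?thesis
    using int by (simp add: distr_deriv_def regular_def)
qed

lemma distr_deriv_sgn:
  assumes \<phi>: "test_fun \<phi>"
  shows "distr_deriv (regular (\<lambda>t. sgn (s - t))) \<phi> = - 2 * \<phi> s"
proof -
  have f: "set_integrable lborel {u..v} (\<lambda>t. sgn (s - t))" for u v
    by (rule sqrt_singular_integrable[OF locally_bounded_imp_singular[OF locally_bounded_sgn]])
  obtain R where R: "R > 0" "\<And>t. \<bar>s - t\<bar> \<ge> R \<Longrightarrow> \<phi> t = 0" "\<And>t. \<bar>s - t\<bar> \<ge> R \<Longrightarrow> deriv \<phi> t = 0"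
    by (rule test_fun_support[OF \<phi>, of s]) (rule that)
  \<comment> \<open>Subtracting \<open>\<phi> s\<close> makes the antiderivative \<open>?g\<close>
    continuous across the jump. Its boundary values are then \<open>\<phi> s\<close> on the right
    and \<open>- \<phi> s\<close> on the left, whence the factor 2.\<close>
  let ?h = "\<lambda>t. sgn (s - t) * deriv \<phi> t" and ?g = "\<lambda>t. sgn (s - t) * (\<phi> t - \<phi> s)"
  have "(?h has_integral ?g (s + R) - ?g (s - R)) {s - R..s + R}"
  proof (rule fundamental_theorem_of_calculus_interior_strong[where S = "{s}"])
    have "isCont ?g t" for t
    proof (cases "t = s")
      case True
      have "\<phi> \<midarrow>s\<rightarrow> \<phi> s"
        using test_fun_isCont[OF \<phi>] by (simp add: isCont_def)
      then have "(\<lambda>t. \<phi> t - \<phi> s) \<midarrow>s\<rightarrow> 0"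
        by (simp add: LIM_zero)
      then have "?g \<midarrow>s\<rightarrow> 0"
        by (rule Lim_null_comparison[rotated, OF tendsto_rabs_zero])
           (auto simp: abs_mult sgn_real_def)
      then show ?thesis using True by (simp add: isCont_def)
    next
      case False
      then show ?thesis
        using test_fun_isCont[OF \<phi>] locally_boundedD(1)[OF locally_bounded_sgn]
        by (intro continuous_intros) auto
    qed
    then show "continuous_on {s - R..s + R} ?g"
      by (simp add: continuous_at_imp_continuous_on)
    fix t assume t: "t \<in> {s - R<..<s + R} - {s}"
    have "\<forall>\<^sub>F x in nhds t. sgn (s - x) = sgn (s - t)"
    proof (cases "t < s")
      case True
      then have "\<forall>\<^sub>F x in nhds t. x < s"
        by (intro order_tendstoD(2)[OF filterlim_ident]) auto
      then show ?thesis by eventually_elim (use True in auto)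
    next
      case False
      then have "\<forall>\<^sub>F x in nhds t. x > s"
        using t by (intro order_tendstoD(1)[OF filterlim_ident]) auto
      then show ?thesis by eventually_elim (use False t in auto)
    qed
    then have "\<forall>\<^sub>F x in nhds t. ?g x = sgn (s - t) * (\<phi> x - \<phi> s)"
      by eventually_elim simp
    moreover have "((\<lambda>x. sgn (s - t) * (\<phi> x - \<phi> s)) has_real_derivative ?h t) (at t)"
      by (auto intro!: derivative_eq_intros test_fun_has_derivative[OF \<phi>])
    ultimately have "(?g has_real_derivative ?h t) (at t)"
      by (subst DERIV_cong_ev[OF refl _ refl])
    then show "(?g has_vector_derivative ?h t) (at t)"
      by (simp add: has_real_derivative_iff_has_vector_derivative)
  qed (use R in auto)
  then have "(?h has_integral 2 * \<phi> s) {s - R..s + R}"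
    using R by simp
  then have "integral\<^sup>L lborel ?h = 2 * \<phi> s"
    by (rule lborel_integral_eq_of_support)
       (use integrable_mult_test_fun(2)[OF f \<phi>] R in \<open>auto simp: abs_if\<close>)
  then show ?thesis
    by (simp add: distr_deriv_def regular_def)
qed


section \<open>Regularization\<close>

text \<open>The case \<open>n = 0\<close> is included: there \<open>1 / real n\<close> is 0, and the
  factor \<open>real n\<close> annihilates \<open>delta_seq\<close>.\<close>

lemma delta_seq_eq_0:
  assumes "mollifier \<eta>" "\<bar>x\<bar> \<ge> 1 / real n"
  shows "delta_seq \<eta> n x = 0"
proof (cases "n = 0")
  case False
  then have "\<bar>real n * x\<bar> \<ge> 1"
    using assms(2) by (simp add: abs_mult field_simps)
  then show ?thesis
    using assms(1) by (simp add: delta_seq_def mollifier_def)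
qed (simp add: delta_seq_def)

lemma delta_seq_nonneg: "mollifier \<eta> \<Longrightarrow> 0 \<le> delta_seq \<eta> n x"
  by (simp add: delta_seq_def mollifier_def)

lemma delta_seq_minus: "mollifier \<eta> \<Longrightarrow> delta_seq \<eta> n (- x) = delta_seq \<eta> n x"
  unfolding delta_seq_def mollifier_def by (metis mult_minus_right)

lemma delta_seq_commute: "mollifier \<eta> \<Longrightarrow> delta_seq \<eta> n (x - y) = delta_seq \<eta> n (y - x)"
  using delta_seq_minus[of \<eta> n "x - y"] by simp

text \<open>Guarantees that \<open>mollify\<close> evaluates its functional at test functions only,
  where hypotheses on distributions apply.\<close>

lemma test_fun_delta_seq:
  assumes "mollifier \<eta>"
  shows "test_fun (\<lambda>y. delta_seq \<eta> n (x - y))"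
proof (rule test_funI)
  have "(\<lambda>y. delta_seq \<eta> n (x - y)) = (\<lambda>y. real n * \<eta> ((- real n) * y + real n * x))"
    by (simp add: delta_seq_def algebra_simps)
  then show "smooth_fun (\<lambda>y. delta_seq \<eta> n (x - y))"
    using assms smooth_fun_affine by (simp only: mollifier_def)
  show "delta_seq \<eta> n (x - y) = 0" if "y \<notin> {x - 1 / n..x + 1 / n}" for y
    by (rule delta_seq_eq_0[OF assms]) (use that in \<open>auto simp: abs_if\<close>)
qed

lemma supp_delta_seq:
  assumes "mollifier \<eta>"
  shows "supp (\<lambda>y. delta_seq \<eta> n (x - y)) \<subseteq> {x - 1 / n..x + 1 / n}"
  by (rule supp_subsetI) (auto intro!: delta_seq_eq_0[OF assms] simp: abs_if)

lemma mollifier_isCont: "mollifier \<eta> \<Longrightarrow> isCont \<eta> x"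
  using smooth_fun_isCont[of \<eta> _ 0] by (simp add: mollifier_def)

lemma mollifier_measurable: "mollifier \<eta> \<Longrightarrow> \<eta> \<in> borel_measurable borel"
  by (intro borel_measurable_continuous_onI continuous_at_imp_continuous_on) (simp add: mollifier_isCont)

lemma delta_seq_measurable:
  assumes "mollifier \<eta>"
  shows "delta_seq \<eta> n \<in> borel_measurable borel"
  unfolding delta_seq_def using mollifier_measurable[OF assms] by measurable

lemma mollifier_bounded:
  assumes "mollifier \<eta>"
  obtains M where "M \<ge> 0" "\<And>n x. \<bar>delta_seq \<eta> n x\<bar> \<le> real n * M"
proof -
  have "\<eta> x = 0" if "x \<notin> {-1..1}" for x
    using assms that by (auto simp: mollifier_def abs_if)
  then obtain M where M: "M \<ge> 0" "\<And>x. \<bar>\<eta> x\<bar> \<le> M"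
    using isCont_bounded_support[OF mollifier_isCont[OF assms]] by metis
  show ?thesis
    by (rule that[OF M(1)]) (use M in \<open>auto simp: delta_seq_def abs_mult intro!: mult_left_mono\<close>)
qed

lemma integrable_mult_delta_seq:
  assumes \<eta>: "mollifier \<eta>" and f: "set_integrable lborel {x - 1 / n..x + 1 / n} f"
  shows "integrable lborel (\<lambda>y. f y * delta_seq \<eta> n (x - y))"
proof -
  note [measurable] = delta_seq_measurable[OF \<eta>]
  obtain M where M: "\<And>n x. \<bar>delta_seq \<eta> n x\<bar> \<le> real n * M"
    by (rule mollifier_bounded[OF \<eta>]) (rule that)
  show ?thesis
    by (rule integrable_mult_bounded_support(1)[OF f _ M])
       (auto intro!: delta_seq_eq_0[OF \<eta>] simp: abs_if)
qed

lemma delta_seq_integral: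
  assumes \<eta>: "mollifier \<eta>" and n: "n > 0"
  shows "(LBINT y. delta_seq \<eta> n (x - y)) = 1"
proof -
  have "(LBINT y. \<eta> y) = real n * (LBINT y. \<eta> (real n * x + (- real n) * y))"
    using lborel_integral_real_affine[of "- real n" \<eta> "real n * x"] n by simp
  also have "\<dots> = (LBINT y. delta_seq \<eta> n (x - y))"
    by (simp add: delta_seq_def algebra_simps)
  moreover have "(LBINT y. \<eta> y) = (LBINT y:{-1..1}. \<eta> y)"
    unfolding set_lebesgue_integral_def
  proof (intro Bochner_Integration.integral_cong refl)
    fix y
    show "\<eta> y = indicator {-1..1} y *\<^sub>R \<eta> y"
    proof (cases "y \<in> {-1..1}")
      case False
      then have "\<bar>y\<bar> \<ge> 1" by auto
      then show ?thesis using \<eta> by (simp add: mollifier_def)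
    qed simp
  qed
  ultimately show ?thesis
    using \<eta> by (simp add: mollifier_def)
qed

lemma mollify_regular: "mollify \<eta> (regular f) n x = (LBINT y. f y * delta_seq \<eta> n (x - y))"
  by (simp add: mollify_def regular_def)

lemma mollify_measurable:
  assumes \<eta>: "mollifier \<eta>" and [measurable]: "f \<in> borel_measurable borel"
  shows "mollify \<eta> (regular f) n \<in> borel_measurable borel"
proof -
  note [measurable] = delta_seq_measurable[OF \<eta>]
  have "(\<lambda>x. LBINT y. f y * delta_seq \<eta> n (x - y)) \<in> borel_measurable borel"
    by (rule lborel.borel_measurable_lebesgue_integral) measurable
  then show ?thesis
    by (simp add: mollify_regular[abs_def])
qed

text \<open>Mollification is an average against a probability density supported within distance
  \<open>1 / n\<close> of \<open>x\<close>. The one-sided form is needed by itself because the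
  pressure has a positive lower bound near \<open>s\<close> but no upper one.\<close>

lemma mollify_regular_lower:
  assumes \<eta>: "mollifier \<eta>" and n: "n > 0"
    and f: "set_integrable lborel {x - 1 / n..x + 1 / n} f"
    and lower: "\<And>y. \<bar>x - y\<bar> \<le> 1 / n \<Longrightarrow> y \<noteq> s \<Longrightarrow> l \<le> f y"
  shows "l \<le> mollify \<eta> (regular f) n x"
proof -
  let ?d = "\<lambda>y. delta_seq \<eta> n (x - y)"
  have l: "integrable lborel (\<lambda>y. l * ?d y)"
    by (rule integrable_mult_delta_seq[OF \<eta>]) (simp add: set_integrable_def)
  have "AE y in lborel. l * ?d y \<le> f y * ?d y"
    using AE_lborel_singleton[of s]
  proof eventually_elim
    case (elim y)
    show ?case
    proof (cases "\<bar>x - y\<bar> \<le> 1 / n")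
      case True
      then show ?thesis
        using lower[OF True elim] delta_seq_nonneg[OF \<eta>] by (intro mult_right_mono)
    next
      case False
      then show ?thesis using delta_seq_eq_0[OF \<eta>, of n "x - y"] by simp
    qed
  qed
  with l integrable_mult_delta_seq[OF \<eta> f]
  have "(LBINT y. l * ?d y) \<le> (LBINT y. f y * ?d y)"
    by (rule integral_mono_AE)
  then show ?thesis
    using delta_seq_integral[OF \<eta> n] by (simp add: mollify_regular)
qed

lemma mollify_regular_bounds:
  assumes \<eta>: "mollifier \<eta>" and n: "n > 0"
    and f: "set_integrable lborel {x - 1 / n..x + 1 / n} f"
    and bounds: "\<And>y. \<bar>x - y\<bar> \<le> 1 / n \<Longrightarrow> y \<noteq> s \<Longrightarrow> l \<le> f y \<and> f y \<le> u"
  shows "l \<le> mollify \<eta> (regular f) n x" "mollify \<eta> (regular f) n x \<le> u"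
proof -
  show "l \<le> mollify \<eta> (regular f) n x"
    by (rule mollify_regular_lower[OF \<eta> n f, of s]) (use bounds in blast)
  have "set_integrable lborel {x - 1 / n..x + 1 / n} (\<lambda>y. - f y)"
    using f by (simp add: set_integrable_def)
  then have "- u \<le> mollify \<eta> (regular (\<lambda>y. - f y)) n x"
    by (rule mollify_regular_lower[OF \<eta> n, of _ _ s]) (use bounds in auto)
  then show "mollify \<eta> (regular f) n x \<le> u"
    by (simp add: mollify_regular)
qed

lemma eventually_inverse_less:
  assumes "(r::real) > 0"
  shows "\<forall>\<^sub>F n in sequentially. n > 0 \<and> 1 / real n < r"
  using eventually_gt_at_top[of 0] order_tendstoD(2)[OF lim_1_over_n assms]
  by eventually_elim simp

lemma mollify_tendsto:
  assumes \<eta>: "mollifier \<eta>" and cont: "isCont f x"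
    and r: "r > 0" and f: "set_integrable lborel {x - r..x + r} f"
  shows "(\<lambda>n. mollify \<eta> (regular f) n x) \<longlonglongrightarrow> f x"
proof (rule tendstoI)
  fix e :: real assume e: "e > 0"
  then obtain d where d: "d > 0" "\<And>y. \<bar>y - x\<bar> < d \<Longrightarrow> \<bar>f y - f x\<bar> < e / 2"
    using cont unfolding continuous_at_eps_delta by (metis dist_real_def half_gt_zero)
  have "\<forall>\<^sub>F n in sequentially. n > 0 \<and> 1 / real n < min d r"
    by (rule eventually_inverse_less) (use d r in auto)
  then show "\<forall>\<^sub>F n in sequentially. dist (mollify \<eta> (regular f) n x) (f x) < e"
  proof eventually_elim
    case (elim n)
    have int: "set_integrable lborel {x - 1 / n..x + 1 / n} f"
      by (rule set_integrable_subset[OF f]) (use elim in auto)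
    have "f x - e / 2 \<le> f y \<and> f y \<le> f x + e / 2" if "\<bar>x - y\<bar> \<le> 1 / n" "y \<noteq> x" for y
    proof -
      have "\<bar>y - x\<bar> < d" using that elim by auto
      from d(2)[OF this] show ?thesis by linarith
    qed
    from mollify_regular_bounds[OF \<eta> _ int this] elim
    have "f x - e / 2 \<le> mollify \<eta> (regular f) n x" "mollify \<eta> (regular f) n x \<le> f x + e / 2"
      by auto
    then show ?case
      using e by (auto simp: dist_real_def abs_if)
  qed
qed

text \<open>Gives the inner limit of a composition, with \<open>n\<close> fixed and
  \<open>y m\<close> a value of the regularized inner function. Integrability on
  \<open>{u..v}\<close> alone is demanded because the outer density \<open>A / x\<close> is not
  integrable near 0; \<open>z\<close> lies deep enough inside that the windows eventually stay in
  \<open>{u..v}\<close>.\<close>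

lemma mollify_seq_continuous:
  assumes \<eta>: "mollifier \<eta>" and f: "set_integrable lborel {u..v} f"
    and y: "y \<longlonglongrightarrow> z" and z: "u < z - 1 / n" "z + 1 / n < v"
  shows "(\<lambda>m. mollify \<eta> (regular f) n (y m)) \<longlonglongrightarrow> mollify \<eta> (regular f) n z"
proof -
  note [measurable] = delta_seq_measurable[OF \<eta>]
  define g where "g y = indicator {u..v} y * f y" for y
  obtain M where M: "\<And>n x. \<bar>delta_seq \<eta> n x\<bar> \<le> real n * M"
    by (rule mollifier_bounded[OF \<eta>]) (rule that)
  have g: "integrable lborel g"
    using f by (simp add: set_integrable_def g_def[abs_def])
  then have [measurable]: "g \<in> borel_measurable lborel"
    by (rule borel_measurable_integrable)
  have eq: "mollify \<eta> (regular f) n w = (LBINT t. g t * delta_seq \<eta> n (w - t))"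
    if "u < w - 1 / n" "w + 1 / n < v" for w
    unfolding mollify_regular
  proof (intro Bochner_Integration.integral_cong refl)
    fix t
    show "f t * delta_seq \<eta> n (w - t) = g t * delta_seq \<eta> n (w - t)"
    proof (cases "t \<in> {u..v}")
      case False
      then have "\<bar>w - t\<bar> \<ge> 1 / n"
        using that unfolding atLeastAtMost_iff by linarith
      then show ?thesis by (simp add: delta_seq_eq_0[OF \<eta>])
    qed (simp add: g_def)
  qed
  have cont: "isCont (delta_seq \<eta> n) x" for x
    unfolding delta_seq_def by (intro continuous_intros isCont_o2[OF _ mollifier_isCont[OF \<eta>]])
  have "(\<lambda>m. LBINT t. g t * delta_seq \<eta> n (y m - t)) \<longlonglongrightarrow> (LBINT t. g t * delta_seq \<eta> n (z - t))"
  proof (rule dominated_convergence_eventually[where w = "\<lambda>t. \<bar>g t\<bar> * (real n * M)"])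
    show "integrable lborel (\<lambda>t. \<bar>g t\<bar> * (real n * M))"
      by (intro integrable_mult_left integrable_abs g)
    show "(\<lambda>m. g t * delta_seq \<eta> n (y m - t)) \<longlonglongrightarrow> g t * delta_seq \<eta> n (z - t)" for t
      by (intro tendsto_intros isCont_tendsto_compose[OF cont] y)
    show "\<forall>\<^sub>F m in sequentially. \<forall>t. t \<noteq> 0 \<longrightarrow> \<bar>g t * delta_seq \<eta> n (y m - t)\<bar> \<le> \<bar>g t\<bar> * (real n * M)"
      by (intro always_eventually allI impI) (simp only: abs_mult, intro mult_left_mono M, simp)
  qed measurable
  moreover have "\<forall>\<^sub>F m in sequentially.
      (LBINT t. g t * delta_seq \<eta> n (y m - t)) = mollify \<eta> (regular f) n (y m)"
  proof -
    have "\<forall>\<^sub>F m in sequentially. u + 1 / n < y m" "\<forall>\<^sub>F m in sequentially. y m < v - 1 / n"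
      by (rule order_tendstoD[OF y]; use z in simp)+
    then show ?thesis
      by eventually_elim (subst eq, auto)
  qed
  ultimately show ?thesis
    using eq[OF z] Lim_transform_eventually by simp
qed

lemma mollify_locally_bounded:
  assumes \<eta>: "mollifier \<eta>" and f: "locally_bounded s f"
  shows "\<exists>K\<ge>0. \<forall>n>0. \<forall>x. \<bar>s - x\<bar> \<le> R \<longrightarrow> \<bar>mollify \<eta> (regular f) n x\<bar> \<le> K"
proof -
  \<comment> \<open>The radius grows by 1 because averaging at \<open>x\<close> uses values at
    distance up to \<open>1 / n \<le> 1\<close>.\<close>
  obtain K where K: "K \<ge> 0" "\<And>t. \<bar>s - t\<bar> \<le> R + 1 \<Longrightarrow> \<bar>f t\<bar> \<le> K"
    using locally_boundedD(2)[OF f, of "R + 1"] by blast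
  have "\<bar>mollify \<eta> (regular f) n x\<bar> \<le> K" if n: "n > 0" and x: "\<bar>s - x\<bar> \<le> R" for n x
  proof -
    have "1 / real n \<le> 1" using n by simp
    then have "- K \<le> f y \<and> f y \<le> K" if "\<bar>x - y\<bar> \<le> 1 / n" for y
      using K(2)[of y] x that by (auto simp: abs_le_iff)
    from mollify_regular_bounds[OF \<eta> n sqrt_singular_integrable[OF locally_bounded_imp_singular[OF f]] this]
    show ?thesis by (simp add: abs_le_iff minus_le_iff)
  qed
  with K(1) show ?thesis by blast
qed

text \<open>The density \<open>delta_seq\<close> is at most \<open>n * M\<close>, while the integral
  of the singularity over a window of radius \<open>1 / n\<close> is at most \<open>8 / n\<close>
  over \<open>sqrt \<bar>s - x\<bar>\<close>. The powers of \<open>n\<close> cancel, which gives a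
  majorant common to all \<open>n\<close>.\<close>

lemma mollify_sqrt_singular:
  assumes \<eta>: "mollifier \<eta>" and f: "sqrt_singular s f"
  shows "\<exists>K\<ge>0. \<forall>n>0. \<forall>x. \<bar>s - x\<bar> \<le> R \<longrightarrow> \<bar>mollify \<eta> (regular f) n x\<bar> * sqrt \<bar>s - x\<bar> \<le> K"
proof -
  note [measurable] = delta_seq_measurable[OF \<eta>]
  obtain K where K: "K \<ge> 0" "\<And>t. \<bar>s - t\<bar> \<le> R + 1 \<Longrightarrow> \<bar>f t\<bar> * sqrt \<bar>s - t\<bar> \<le> K"
    using sqrt_singularD(2)[OF f, of "R + 1"] by blast
  obtain M where M: "M \<ge> 0" "\<And>n x. \<bar>delta_seq \<eta> n x\<bar> \<le> real n * M"
    by (rule mollifier_bounded[OF \<eta>]) (rule that)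
  have "\<bar>mollify \<eta> (regular f) n x\<bar> * sqrt \<bar>s - x\<bar> \<le> 8 * M * K"
    if n: "n > 0" and x: "\<bar>s - x\<bar> \<le> R" for n x
  proof (cases "x = s")
    case True
    then show ?thesis using K(1) M(1) by simp
  next
    case False
    let ?e = "1 / real n"
    have e: "?e \<le> 1" "?e > 0" using n by auto
    have "\<bar>mollify \<eta> (regular f) n x\<bar> \<le> real n * M * (LBINT t:{x - ?e..x + ?e}. \<bar>f t\<bar>)"
      unfolding mollify_regular
      by (rule integrable_mult_bounded_support(2)[OF sqrt_singular_integrable[OF f] _ M(2)])
         (auto intro!: delta_seq_eq_0[OF \<eta>] simp: abs_if)
    also have "\<dots> \<le> real n * M * (K * (2 * sqrt (s - (x - ?e)) - 2 * sqrt (s - (x + ?e))))"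
    proof (intro mult_left_mono sqrt_singular_integral_bound(2)[OF f])
      fix t assume "t \<in> {x - ?e..x + ?e}"
      then have "\<bar>s - t\<bar> \<le> R + 1"
        using e(1) x unfolding atLeastAtMost_iff by linarith
      then show "\<bar>f t\<bar> * sqrt \<bar>s - t\<bar> \<le> K"
        by (rule K(2))
    qed (use e M n in auto)
    finally have "\<bar>mollify \<eta> (regular f) n x\<bar> * sqrt \<bar>s - x\<bar>
        \<le> real n * M * (K * (2 * sqrt (s - (x - ?e)) - 2 * sqrt (s - (x + ?e)))) * sqrt \<bar>s - x\<bar>"
      by (rule mult_right_mono) simp
    also have "\<dots> = real n * M * K * ((2 * sqrt ((s - x) + ?e) - 2 * sqrt ((s - x) - ?e)) * sqrt \<bar>s - x\<bar>)"
      by (simp add: algebra_simps)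
    also have "\<dots> \<le> real n * M * K * (8 * ?e)"
      by (rule mult_left_mono[OF sqrt_increment_bound]) (use e False M K in auto)
    also have "\<dots> = 8 * M * K"
      using n by simp
    finally show ?thesis .
  qed
  moreover have "8 * M * K \<ge> 0"
    using K(1) M(1) by simp
  ultimately show ?thesis by blast
qed


section \<open>Products and compositions\<close>

lemma mollify_reflect:
  assumes \<eta>: "mollifier \<eta>" and odd: "\<And>t. f (2 * s - t) = - f t"
  shows "mollify \<eta> (regular f) n (2 * s - x) = - mollify \<eta> (regular f) n x"
proof -
  have "mollify \<eta> (regular f) n (2 * s - x)
      = (LBINT t. f (2 * s + (- 1) * t) * delta_seq \<eta> n (2 * s - x - (2 * s + (- 1) * t)))"
    unfolding mollify_regular by (subst lborel_integral_real_affine[of "- 1" _ "2 * s"]) simp_all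
  also have "\<dots> = (LBINT t. - (f t * delta_seq \<eta> n (x - t)))"
    using odd delta_seq_commute[OF \<eta>, of n x] by simp
  finally show ?thesis
    by (simp add: mollify_regular)
qed

lemma set_integrable_bounded:
  fixes h :: "real \<Rightarrow> real"
  assumes [measurable]: "h \<in> borel_measurable borel" and K: "\<And>x. x \<in> {u..v} \<Longrightarrow> \<bar>h x\<bar> \<le> K"
  shows "set_integrable lborel {u..v} h"
  unfolding set_integrable_def
proof (rule Bochner_Integration.integrable_bound[of _ "\<lambda>x. K * indicator {u..v} x"])
  show "AE x in lborel. norm (indicator {u..v} x *\<^sub>R h x) \<le> norm (K * indicator {u..v} x :: real)"
    using K by (intro AE_I2) (fastforce simp: indicator_def)
  show "integrable lborel (\<lambda>x. K * indicator {u..v} x)"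
    by (intro integrable_mult_right integrable_real_indicator) (auto simp: emeasure_lborel_Icc_eq)
qed simp

text \<open>Split the test function as \<open>\<phi> s\<close> plus
  \<open>\<phi> x - \<phi> s\<close>. The constant part meets an odd function and an even density,
  so its integral is exactly 0 for large \<open>n\<close>; the rest is at most \<open>K * d\<close>,
  as the mollified \<open>f\<close> is bounded by \<open>K\<close> uniformly in
  \<open>n\<close>.\<close>

lemma mollify_odd_times_delta_seq:
  assumes \<eta>: "mollifier \<eta>" and f: "locally_bounded s f" and odd: "\<And>t. f (2 * s - t) = - f t"
    and \<phi>: "test_fun \<phi>"
  shows "(\<lambda>n. LBINT x. mollify \<eta> (regular f) n x * \<phi> x * delta_seq \<eta> n (x - s)) \<longlonglongrightarrow> 0"
proof (rule tendstoI)
  fix e :: real assume e: "e > 0"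
  have [measurable]: "f \<in> borel_measurable borel"
    by (rule sqrt_singular_measurable[OF locally_bounded_imp_singular[OF f]])
  note [measurable] = mollify_measurable[OF \<eta>] test_fun_measurable[OF \<phi>]
  let ?f = "\<lambda>n. mollify \<eta> (regular f) n"
  obtain K where K: "K \<ge> 0" "\<And>n x. n > 0 \<Longrightarrow> \<bar>s - x\<bar> \<le> 1 \<Longrightarrow> \<bar>?f n x\<bar> \<le> K"
    using mollify_locally_bounded[OF \<eta> f, of 1] by blast
  define d where "d = e / (2 * (K + 1))"
  have d: "d > 0" "K * d < e"
    using e K(1) mult_nonneg_nonneg[OF K(1), of e] by (auto simp: d_def field_simps add_nonneg_pos)
  then obtain r where r: "r > 0" "\<And>y. \<bar>y - s\<bar> < r \<Longrightarrow> \<bar>\<phi> y - \<phi> s\<bar> < d"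
    using test_fun_isCont[OF \<phi>, of s] unfolding continuous_at_eps_delta by (metis dist_real_def)
  have "\<forall>\<^sub>F n in sequentially. n > 0 \<and> 1 / real n < min r 1"
    by (rule eventually_inverse_less) (use r in auto)
  then show "\<forall>\<^sub>F n in sequentially.
      dist (LBINT x. ?f n x * \<phi> x * delta_seq \<eta> n (x - s)) 0 < e"
  proof eventually_elim
    case (elim n)
    have close: "\<bar>?f n x\<bar> \<le> K" "\<bar>\<phi> x - \<phi> s\<bar> \<le> d" if "\<bar>s - x\<bar> \<le> 1 / n" for x
    proof -
      show "\<bar>?f n x\<bar> \<le> K" by (rule K(2)) (use elim that in auto)
      have "\<bar>x - s\<bar> < r" using elim that by auto
      from r(2)[OF this] show "\<bar>\<phi> x - \<phi> s\<bar> \<le> d" by simp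
    qed
    have small: "\<bar>?f n x * (\<phi> x - \<phi> s)\<bar> \<le> K * d" if "\<bar>s - x\<bar> \<le> 1 / n" for x
      using mult_mono[OF close[OF that]] K(1) by (simp add: abs_mult)
    have int1: "set_integrable lborel {s - 1 / n..s + 1 / n} (\<lambda>x. ?f n x * (\<phi> x - \<phi> s))"
      by (rule set_integrable_bounded[OF _ small]) auto
    have int2: "set_integrable lborel {s - 1 / n..s + 1 / n} (?f n)"
      by (rule set_integrable_bounded[OF _ close(1)]) auto
    have "?f n x * \<phi> x * delta_seq \<eta> n (x - s)
        = ?f n x * (\<phi> x - \<phi> s) * delta_seq \<eta> n (s - x) + \<phi> s * (?f n x * delta_seq \<eta> n (s - x))" for x
      using delta_seq_commute[OF \<eta>, of n x s] by (simp add: algebra_simps)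
    then have "(LBINT x. ?f n x * \<phi> x * delta_seq \<eta> n (x - s))
        = mollify \<eta> (regular (\<lambda>x. ?f n x * (\<phi> x - \<phi> s))) n s + \<phi> s * mollify \<eta> (regular (?f n)) n s"
      using integrable_mult_delta_seq[OF \<eta> int1] integrable_mult_delta_seq[OF \<eta> int2]
      by (simp flip: mollify_regular)
    \<comment> \<open>Integration against the delta sequence at \<open>s\<close> is a second
      mollification. Oddness about \<open>s\<close> survives both, and \<open>s\<close> is the fixed
      point of the reflection.\<close>
    moreover have "mollify \<eta> (regular (?f n)) n s = 0"
    proof -
      have "?f n (2 * s - x) = - ?f n x" for x
        by (rule mollify_reflect[OF \<eta>]) (rule odd)
      then have "mollify \<eta> (regular (?f n)) n (2 * s - s) = - mollify \<eta> (regular (?f n)) n s"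
        by (rule mollify_reflect[OF \<eta>])
      then show ?thesis by simp
    qed
    moreover have "- (K * d) \<le> ?f n x * (\<phi> x - \<phi> s) \<and> ?f n x * (\<phi> x - \<phi> s) \<le> K * d"
      if "\<bar>s - x\<bar> \<le> 1 / n" for x
      using small[OF that] by (simp add: abs_le_iff minus_le_iff)
    with mollify_regular_bounds[OF \<eta> _ int1, of s "- (K * d)" "K * d"] elim
    have "\<bar>mollify \<eta> (regular (\<lambda>x. ?f n x * (\<phi> x - \<phi> s))) n s\<bar> \<le> K * d"
      by (auto simp: abs_le_iff minus_le_iff)
    ultimately show ?case
      using d(2) by simp
  qed
qed

text \<open>Uniform bounds for the two mollified factors multiply to a majorant \<open>w\<close>
  with an integrable inverse square root singularity. The second part permits splitting off the
  delta contribution under the integral.\<close>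

lemma mollify_mult_tendsto:
  assumes \<eta>: "mollifier \<eta>" and f: "locally_bounded s f" and g: "sqrt_singular s g" and \<phi>: "test_fun \<phi>"
  shows "(\<lambda>n. LBINT x. mollify \<eta> (regular f) n x * mollify \<eta> (regular g) n x * \<phi> x)
      \<longlonglongrightarrow> regular (\<lambda>t. f t * g t) \<phi>"
    and "n > 0 \<Longrightarrow> integrable lborel
      (\<lambda>x. mollify \<eta> (regular f) n x * mollify \<eta> (regular g) n x * \<phi> x)"
proof -
  note fs = locally_bounded_imp_singular[OF f]
  note [measurable] = sqrt_singular_measurable[OF fs] sqrt_singular_measurable[OF g]
    mollify_measurable[OF \<eta>] test_fun_measurable[OF \<phi>]
  let ?f = "\<lambda>n. mollify \<eta> (regular f) n" and ?g = "\<lambda>n. mollify \<eta> (regular g) n"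
  obtain R where R: "R > 0" "\<And>t. \<bar>s - t\<bar> \<ge> R \<Longrightarrow> \<phi> t = 0"
    by (rule test_fun_support[OF \<phi>, of s]) (rule that)
  obtain K where K: "K \<ge> 0" "\<And>n x. n > 0 \<Longrightarrow> \<bar>s - x\<bar> \<le> R \<Longrightarrow> \<bar>?f n x\<bar> \<le> K"
    using mollify_locally_bounded[OF \<eta> f, of R] by blast
  obtain L where L: "L \<ge> 0" "\<And>n x. n > 0 \<Longrightarrow> \<bar>s - x\<bar> \<le> R \<Longrightarrow> \<bar>?g n x\<bar> * sqrt \<bar>s - x\<bar> \<le> L"
    using mollify_sqrt_singular[OF \<eta> g, of R] by blast
  obtain M where M: "M \<ge> 0" "\<And>t. \<bar>\<phi> t\<bar> \<le> M"
    by (rule test_fun_bounded[OF \<phi>]) (rule that)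
  define w where "w x = K * L * M * (indicator {s - R..s + R} x * (1 / sqrt \<bar>s - x\<bar>))" for x
  have w: "integrable lborel w"
    unfolding w_def using inverse_sqrt_integral(1)[of "s - R" "s + R" s]
    by (intro integrable_mult_right) (simp add: set_integrable_def)
  have bound: "\<bar>?f n x * ?g n x * \<phi> x\<bar> \<le> w x" if n: "n > 0" and x: "x \<noteq> s" for n x
  proof (cases "\<bar>s - x\<bar> \<le> R")
    case True
    have "\<bar>?g n x\<bar> \<le> L / sqrt \<bar>s - x\<bar>"
      using L(2)[OF n True] x by (simp add: field_simps)
    then have "\<bar>?f n x\<bar> * \<bar>?g n x\<bar> * \<bar>\<phi> x\<bar> \<le> K * (L / sqrt \<bar>s - x\<bar>) * M"
      using K L(1) M n True by (intro mult_mono) auto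
    moreover have "x \<in> {s - R..s + R}"
      using True by auto
    ultimately show ?thesis
      by (simp add: w_def abs_mult)
  next
    case False
    then have "x \<notin> {s - R..s + R}" by auto
    then show ?thesis using R(2)[of x] False by (simp add: w_def)
  qed
  show "(\<lambda>n. LBINT x. ?f n x * ?g n x * \<phi> x) \<longlonglongrightarrow> regular (\<lambda>t. f t * g t) \<phi>"
    unfolding regular_def[of "\<lambda>t. f t * g t"]
  proof (rule dominated_convergence_eventually[OF _ _ w])
    show "\<forall>\<^sub>F n in sequentially. \<forall>x. x \<noteq> s \<longrightarrow> \<bar>?f n x * ?g n x * \<phi> x\<bar> \<le> w x"
      using eventually_gt_at_top[of 0] by eventually_elim (use bound in auto)
    show "(\<lambda>n. ?f n x * ?g n x * \<phi> x) \<longlonglongrightarrow> f x * g x * \<phi> x" if "x \<noteq> s" for x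
      using locally_boundedD(1)[OF f that] sqrt_singularD(1)[OF g that]
        sqrt_singular_integrable[OF fs] sqrt_singular_integrable[OF g]
      by (intro tendsto_intros mollify_tendsto[OF \<eta> _ zero_less_one]) auto
  qed auto
  assume n: "n > 0"
  show "integrable lborel (\<lambda>x. ?f n x * ?g n x * \<phi> x)"
  proof (rule Bochner_Integration.integrable_bound[OF w])
    show "AE x in lborel. norm (?f n x * ?g n x * \<phi> x) \<le> norm (w x)"
      using AE_lborel_singleton[of s]
    proof eventually_elim
      case (elim x)
      show ?case using bound[OF n elim] unfolding real_norm_def by linarith
    qed
  qed simp
qed

lemma is_distribution_regular_plus_dirac:
  assumes g: "sqrt_singular s g" and T: "\<And>\<phi>. test_fun \<phi> \<Longrightarrow> T \<phi> = regular g \<phi> + \<kappa> * \<phi> s"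
  shows "is_distribution T"
proof (rule is_distribution_cong)
  show "is_distribution (\<lambda>\<phi>. 1 * regular g \<phi> + \<kappa> * dirac s \<phi>)"
    by (intro is_distribution_lincomb is_distribution_dirac is_distribution_regular
        sqrt_singular_integrable[OF g])
qed (simp add: T dirac_def)

lemma mollify_regular_plus_dirac:
  assumes \<eta>: "mollifier \<eta>" and T: "\<And>\<phi>. test_fun \<phi> \<Longrightarrow> T \<phi> = regular g \<phi> + \<kappa> * \<phi> s"
  shows "mollify \<eta> T n x = mollify \<eta> (regular g) n x + \<kappa> * delta_seq \<eta> n (x - s)"
  by (simp add: mollify_def T[OF test_fun_delta_seq[OF \<eta>]])

text \<open>Since \<open>\<delta>\<^sub>n\<close> is even, it annihilates odd factors in the limit.\<close>

lemma has_product_on_regular_dirac: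
  assumes \<eta>: "mollifier \<eta>" and f: "locally_bounded s f" and g: "sqrt_singular s g"
    and odd: "\<kappa> \<noteq> 0 \<Longrightarrow> (\<And>t. f (2 * s - t) = - f t)"
    and S: "\<And>\<phi>. test_fun \<phi> \<Longrightarrow> S \<phi> = regular f \<phi>"
    and T: "\<And>\<phi>. test_fun \<phi> \<Longrightarrow> T \<phi> = regular g \<phi> + \<kappa> * \<phi> s"
  shows "has_product_on \<eta> b c S T (regular (\<lambda>t. f t * g t))"
  unfolding has_product_on_def
proof (intro conjI allI impI)
  note fs = locally_bounded_imp_singular[OF f]
  show "is_distribution S"
    by (rule is_distribution_regular_plus_dirac[OF fs, of _ 0]) (simp add: S)
  show "is_distribution T"
    by (rule is_distribution_regular_plus_dirac[OF g T])
  show "is_distribution (regular (\<lambda>t. f t * g t))"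
    by (intro is_distribution_regular sqrt_singular_integrable[OF locally_bounded_mult_singular[OF f g]])
  fix \<phi> assume \<phi>: "test_fun \<phi>"
  note [measurable] = sqrt_singular_measurable[OF fs] mollify_measurable[OF \<eta>] test_fun_measurable[OF \<phi>]
  let ?f = "\<lambda>n. mollify \<eta> (regular f) n" and ?g = "\<lambda>n. mollify \<eta> (regular g) n"
  let ?D = "\<lambda>n. LBINT x. ?f n x * \<phi> x * delta_seq \<eta> n (x - s)"
  \<comment> \<open>Oddness is available only for \<open>\<kappa> \<noteq> 0\<close>; the case
    \<open>\<kappa> = 0\<close> covers products of plain functions such as
    \<open>H * H\<close>.\<close>
  have "(\<lambda>n. \<kappa> * ?D n) \<longlonglongrightarrow> 0"
    using mollify_odd_times_delta_seq[OF \<eta> f odd \<phi>] by (cases "\<kappa> = 0") (auto intro: tendsto_mult_right_zero)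
  then have "(\<lambda>n. (LBINT x. ?f n x * ?g n x * \<phi> x) + \<kappa> * ?D n) \<longlonglongrightarrow> regular (\<lambda>t. f t * g t) \<phi> + 0"
    by (rule tendsto_add[OF mollify_mult_tendsto(1)[OF \<eta> f g \<phi>]])
  moreover have "\<forall>\<^sub>F n in sequentially. (LBINT x. ?f n x * ?g n x * \<phi> x) + \<kappa> * ?D n
      = regular (\<lambda>x. mollify \<eta> S n x * mollify \<eta> T n x) \<phi>"
    using eventually_gt_at_top[of 0]
  proof eventually_elim
    case (elim n)
    obtain K where K: "K \<ge> 0" "\<And>x. \<bar>s - x\<bar> \<le> 1 \<Longrightarrow> \<bar>?f n x\<bar> \<le> K"
      using mollify_locally_bounded[OF \<eta> f, of 1] elim by blast
    obtain M where M: "M \<ge> 0" "\<And>t. \<bar>\<phi> t\<bar> \<le> M"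
      by (rule test_fun_bounded[OF \<phi>]) (rule that)
    have "set_integrable lborel {s - 1 / n..s + 1 / n} (\<lambda>x. ?f n x * \<phi> x)"
    proof (rule set_integrable_bounded)
      fix x assume "x \<in> {s - 1 / real n..s + 1 / n}"
      moreover have "1 / real n \<le> 1" using elim by simp
      ultimately have "\<bar>s - x\<bar> \<le> 1" unfolding atLeastAtMost_iff by linarith
      then show "\<bar>?f n x * \<phi> x\<bar> \<le> K * M"
        unfolding abs_mult using K M by (intro mult_mono) auto
    qed simp
    from integrable_mult_delta_seq[OF \<eta> this]
    have "integrable lborel (\<lambda>x. ?f n x * \<phi> x * delta_seq \<eta> n (x - s))"
      using delta_seq_commute[OF \<eta>, of n s] by simp
    then have "(LBINT x. ?f n x * ?g n x * \<phi> x) + \<kappa> * ?D n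
        = (LBINT x. ?f n x * ?g n x * \<phi> x + \<kappa> * (?f n x * \<phi> x * delta_seq \<eta> n (x - s)))"
      using mollify_mult_tendsto(2)[OF \<eta> f g \<phi> elim] by simp
    also have "\<dots> = regular (\<lambda>x. mollify \<eta> S n x * mollify \<eta> T n x) \<phi>"
      unfolding regular_def[of "\<lambda>x. mollify \<eta> S n x * mollify \<eta> T n x"]
      using mollify_regular_plus_dirac[OF \<eta>, of S f 0 s] mollify_regular_plus_dirac[OF \<eta>, of T g \<kappa> s]
      by (simp add: S T algebra_simps)
    finally show ?case .
  qed
  ultimately show "(\<lambda>n. regular (\<lambda>x. mollify \<eta> S n x * mollify \<eta> T n x) \<phi>)
      \<longlonglongrightarrow> regular (\<lambda>t. f t * g t) \<phi>"
    using Lim_transform_eventually by simp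
qed

text \<open>The regularized pressure stays above a positive constant near the support of the test
  function, so that only the values of \<open>F\<close> on the positive axis matter, and for a fixed \<open>n\<close> it
  converges off \<open>s\<close> to \<open>p\<close>, whatever the weight of the \<open>\<delta>\<close>-term.\<close>

lemma has_composition_on_reciprocal:
  assumes \<eta>: "mollifier \<eta>" and A: "A \<ge> 0" and p: "sqrt_singular s p" and \<kappa>: "\<kappa> \<ge> 0"
    and pos: "\<And>R. \<exists>m>0. \<forall>t. t \<noteq> s \<longrightarrow> \<bar>s - t\<bar> \<le> R \<longrightarrow> m \<le> p t"
    and q: "locally_bounded s q" "\<And>t. t \<noteq> s \<Longrightarrow> q t = A / p t"
    and F: "is_distribution F" "distr_eq_on {0<..} F (regular (\<lambda>x. A / x))"
    and T: "\<And>\<phi>. test_fun \<phi> \<Longrightarrow> T \<phi> = regular p \<phi> + \<kappa> * \<phi> s"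
  shows "has_composition_on \<eta> b c F T (regular q)"
  unfolding has_composition_on_def
proof (intro conjI allI impI)
  note qs = locally_bounded_imp_singular[OF q(1)]
  show "is_distribution F" by fact
  show "is_distribution T"
    by (rule is_distribution_regular_plus_dirac[OF p T])
  show "is_distribution (regular q)"
    by (intro is_distribution_regular sqrt_singular_integrable[OF qs])
  fix \<phi> assume \<phi>: "test_fun \<phi>" and supp: "supp \<phi> \<subseteq> {b<..<c}"
  define G where "G x = A / x" for x :: real
  have [measurable]: "G \<in> borel_measurable borel"
    unfolding G_def by measurable
  note [measurable] = sqrt_singular_measurable[OF p] sqrt_singular_measurable[OF qs]
    mollify_measurable[OF \<eta>] test_fun_measurable[OF \<phi>] delta_seq_measurable[OF \<eta>]
  have G: "set_integrable lborel {u..v} G" if "u > 0" for u v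
    unfolding G_def by (intro borel_integrable_atLeastAtMost') (use that in \<open>auto intro!: continuous_intros\<close>)
  let ?G = "\<lambda>n. mollify \<eta> (regular G) n" and ?p = "\<lambda>k. mollify \<eta> T k"
  have p_eq: "?p k x = mollify \<eta> (regular p) k x + \<kappa> * delta_seq \<eta> k (x - s)" for k x
    by (rule mollify_regular_plus_dirac[OF \<eta> T])
  have [measurable]: "?p k \<in> borel_measurable borel" for k
    unfolding p_eq[abs_def] by measurable
  \<comment> \<open>The strict inequality puts the closed window around \<open>y\<close> inside
    \<open>{0<..}\<close>, where \<open>F\<close> is prescribed.\<close>
  have F_eq: "mollify \<eta> F n y = ?G n y" if "y > 1 / n" for n y
  proof -
    have "supp (\<lambda>z. delta_seq \<eta> n (y - z)) \<subseteq> {0<..}"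
      using supp_delta_seq[OF \<eta>, of n y] that by force
    then show ?thesis
      using F(2) test_fun_delta_seq[OF \<eta>, of n y]
      unfolding distr_eq_on_def mollify_def G_def[abs_def] by blast
  qed
  obtain R where R: "R > 0" "\<And>t. \<bar>s - t\<bar> \<ge> R \<Longrightarrow> \<phi> t = 0"
    by (rule test_fun_support[OF \<phi>, of s]) (rule that)
  obtain m where m: "m > 0" "\<And>t. t \<noteq> s \<Longrightarrow> \<bar>s - t\<bar> \<le> R + 1 \<Longrightarrow> m \<le> p t"
    using pos[of "R + 1"] by blast
  have p_lower: "m \<le> ?p k x" if k: "k > 0" and x: "\<bar>s - x\<bar> < R" for k x
  proof -
    have "m \<le> p y" if "\<bar>x - y\<bar> \<le> 1 / k" "y \<noteq> s" for y
    proof (rule m(2)[OF that(2)])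
      have "1 / real k \<le> 1" using k by simp
      then show "\<bar>s - y\<bar> \<le> R + 1" using that(1) x by linarith
    qed
    then have "m \<le> mollify \<eta> (regular p) k x"
      by (rule mollify_regular_lower[OF \<eta> k sqrt_singular_integrable[OF p]])
    moreover have "0 \<le> \<kappa> * delta_seq \<eta> k (x - s)"
      using \<kappa> delta_seq_nonneg[OF \<eta>] by simp
    ultimately show ?thesis by (simp add: p_eq)
  qed
  have int_\<phi>: "integrable lborel (\<lambda>x. A / (m / 2) * \<bar>\<phi> x\<bar>)"
  proof -
    have "integrable lborel (\<lambda>x. 1 * \<phi> x)"
      by (rule integrable_mult_test_fun(1)[OF borel_integrable_atLeastAtMost' \<phi>]) auto
    then show ?thesis
      by (intro integrable_mult_right integrable_abs) simp
  qed
  \<comment> \<open>With \<open>1 / n < m / 2\<close> the window around any \<open>y \<ge> m\<close>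
    stays above \<open>m / 2\<close>. The bound does not involve the size of \<open>y\<close>, so
    the peak of the delta sequence in the regularized pressure does no harm.\<close>
  have G_bound: "\<bar>?G n y * \<phi> x\<bar> \<le> A / (m / 2) * \<bar>\<phi> x\<bar>"
    if n: "n > 0" "1 / real n < m / 2" and y: "y \<ge> m" for n x y
  proof -
    have yn: "0 < m / 2" "m / 2 \<le> y - 1 / n" using n y m(1) by auto
    have "0 \<le> G z \<and> G z \<le> A / (m / 2)" if "\<bar>y - z\<bar> \<le> 1 / n" for z
    proof -
      have "m / 2 \<le> z" using that yn by (simp add: abs_le_iff)
      then show ?thesis
        unfolding G_def using A yn(1) by (intro conjI divide_nonneg_pos divide_left_mono mult_pos_pos) linarith+
    qed
    from mollify_regular_bounds[OF \<eta> n(1) G this] yn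
    have "0 \<le> ?G n y" "?G n y \<le> A / (m / 2)"
      by auto
    then show ?thesis
      unfolding abs_mult by (intro mult_right_mono) auto
  qed
  have large: "\<forall>\<^sub>F n in sequentially. n > 0 \<and> 1 / real n < m / 2"
    by (rule eventually_inverse_less) (use m in simp)
  \<comment> \<open>The inner limit replaces the regularized pressure by \<open>p\<close> itself,
    and the delta-term is already gone before \<open>n\<close> varies.\<close>
  define L where "L n = (LBINT x. ?G n (p x) * \<phi> x)" for n
  show "\<exists>L. (\<forall>\<^sub>F n in sequentially.
        (\<lambda>k. LBINT x:{b<..<c}. mollify \<eta> F n (mollify \<eta> T k x) * \<phi> x) \<longlonglongrightarrow> L n) \<and>
      L \<longlonglongrightarrow> regular q \<phi>"
  proof (intro exI[of _ L] conjI)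
    show "\<forall>\<^sub>F n in sequentially.
        (\<lambda>k. LBINT x:{b<..<c}. mollify \<eta> F n (?p k x) * \<phi> x) \<longlonglongrightarrow> L n"
      using large
    proof eventually_elim
      case (elim n)
      have "(\<lambda>k. LBINT x. ?G n (?p k x) * \<phi> x) \<longlonglongrightarrow> L n"
        unfolding L_def
      proof (rule dominated_convergence_eventually[OF _ _ int_\<phi>, where s = s])
        show "\<forall>\<^sub>F k in sequentially. \<forall>x. x \<noteq> s \<longrightarrow> \<bar>?G n (?p k x) * \<phi> x\<bar> \<le> A / (m / 2) * \<bar>\<phi> x\<bar>"
          using eventually_gt_at_top[of 0]
        proof eventually_elim
          case (elim k)
          have "\<bar>?G n (?p k x) * \<phi> x\<bar> \<le> A / (m / 2) * \<bar>\<phi> x\<bar>" for x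
          proof (cases "\<bar>s - x\<bar> < R")
            case True
            show ?thesis
              by (rule G_bound) (use p_lower[OF elim True] \<open>n > 0 \<and> 1 / real n < m / 2\<close> in auto)
          qed (use R(2)[of x] in simp)
          then show ?case by simp
        qed
        fix x assume x: "x \<noteq> s"
        show "(\<lambda>k. ?G n (?p k x) * \<phi> x) \<longlonglongrightarrow> ?G n (p x) * \<phi> x"
        proof (cases "\<bar>s - x\<bar> < R")
          case True
          have "\<forall>\<^sub>F k in sequentially. \<kappa> * delta_seq \<eta> k (x - s) = 0"
          proof -
            have "\<forall>\<^sub>F k in sequentially. k > 0 \<and> 1 / real k < \<bar>x - s\<bar>"
              by (rule eventually_inverse_less) (use x in simp)
            then show ?thesis
              by eventually_elim (simp add: delta_seq_eq_0[OF \<eta>])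
          qed
          then have "(\<lambda>k. \<kappa> * delta_seq \<eta> k (x - s)) \<longlonglongrightarrow> 0"
            by (rule tendsto_eventually)
          from tendsto_add[OF mollify_tendsto[OF \<eta> sqrt_singularD(1)[OF p x] zero_less_one
                sqrt_singular_integrable[OF p]] this]
          have lim: "(\<lambda>k. ?p k x) \<longlonglongrightarrow> p x"
            by (simp add: p_eq)
          have px: "p x - 1 / n > 0"
          proof -
            have "m \<le> p x" using m(2)[OF x] True by simp
            then show ?thesis using elim m(1) by linarith
          qed
          \<comment> \<open>The interval strictly contains the window of radius \<open>1 / n\<close>
            around \<open>p x\<close>; halving its lower end keeps the left endpoint positive, so
            that \<open>G\<close> is integrable there.\<close>
          have "(\<lambda>k. ?G n (?p k x)) \<longlonglongrightarrow> ?G n (p x)"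
            by (rule mollify_seq_continuous[OF \<eta> G lim, of "(p x - 1 / n) / 2" _ "p x + 1 / n + 1"])
               (use px in \<open>auto simp: field_simps\<close>)
          then show ?thesis by (intro tendsto_intros)
        qed (use R(2)[of x] in simp)
      qed measurable
      moreover have "\<forall>\<^sub>F k in sequentially. (LBINT x. ?G n (?p k x) * \<phi> x)
          = (LBINT x:{b<..<c}. mollify \<eta> F n (?p k x) * \<phi> x)"
        using eventually_gt_at_top[of 0]
      proof eventually_elim
        case (elim k)
        show ?case
          unfolding set_lebesgue_integral_def
        proof (intro Bochner_Integration.integral_cong refl)
          fix x
          show "?G n (?p k x) * \<phi> x = indicator {b<..<c} x *\<^sub>R (mollify \<eta> F n (?p k x) * \<phi> x)"
          proof (cases "\<phi> x = 0")
            case False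
            then have "\<bar>s - x\<bar> < R" using R(2)[of x] by force
            from p_lower[OF elim this] have "?p k x > 1 / n"
              using \<open>n > 0 \<and> 1 / real n < m / 2\<close> m(1) by linarith
            moreover have "x \<in> {b<..<c}"
              using False supp eq_0_outside_supp by blast
            ultimately show ?thesis by (simp add: F_eq)
          qed simp
        qed
      qed
      ultimately show ?case
        by (rule Lim_transform_eventually)
    qed
    show "L \<longlonglongrightarrow> regular q \<phi>"
      unfolding L_def[abs_def] regular_def[of q]
    proof (rule dominated_convergence_eventually[OF _ _ int_\<phi>, where s = s])
      show "\<forall>\<^sub>F n in sequentially. \<forall>x. x \<noteq> s \<longrightarrow> \<bar>?G n (p x) * \<phi> x\<bar>
          \<le> A / (m / 2) * \<bar>\<phi> x\<bar>"
        using large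
      proof eventually_elim
        case (elim n)
        have "\<bar>?G n (p x) * \<phi> x\<bar> \<le> A / (m / 2) * \<bar>\<phi> x\<bar>" if "x \<noteq> s" for x
        proof (cases "\<bar>s - x\<bar> < R")
          case True
          show ?thesis
            by (rule G_bound) (use m(2)[OF that] True elim in auto)
        qed (use R(2)[of x] in simp)
        then show ?case by simp
      qed
      fix x assume x: "x \<noteq> s"
      show "(\<lambda>n. ?G n (p x) * \<phi> x) \<longlonglongrightarrow> q x * \<phi> x"
      proof (cases "\<bar>s - x\<bar> < R")
        case True
        then have px: "p x > 0" using m(2)[OF x] m(1) by simp
        have "isCont G (p x)"
          unfolding G_def using px by (intro continuous_intros) auto
        then have "(\<lambda>n. ?G n (p x)) \<longlonglongrightarrow> G (p x)"
          by (rule mollify_tendsto[OF \<eta> _ _ G, of _ "p x / 2"]) (use px in auto)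
        then have "(\<lambda>n. ?G n (p x)) \<longlonglongrightarrow> q x"
          by (simp add: q(2)[OF x] G_def)
        then show ?thesis by (intro tendsto_intros)
      qed (use R(2)[of x] in simp)
    qed measurable
  qed
qed


section \<open>Leading terms at the singularity\<close>

text \<open>Up to a sign, all expressions depend on \<open>t\<close> through
  \<open>u = \<bar>s - t\<bar>\<close>, so one-sided expansions at \<open>u = 0\<close> serve both
  sides of \<open>s\<close>.\<close>

lemma filterlim_abs_diff: "filterlim (\<lambda>t. \<bar>s - t\<bar>) (at_right 0) (at (s::real))"
  unfolding filterlim_at
proof
  show "\<forall>\<^sub>F t in at s. \<bar>s - t\<bar> \<in> {0<..} \<and> \<bar>s - t\<bar> \<noteq> 0"
    by (auto simp: eventually_at intro: exI[of _ 1])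
  have "isCont (\<lambda>t. \<bar>s - t\<bar>) s"
    by (intro continuous_intros)
  then show "((\<lambda>t. \<bar>s - t\<bar>) \<longlongrightarrow> 0) (at s)"
    by (simp add: isCont_def)
qed

lemma locally_bounded_bigo:
  assumes "locally_bounded s f"
  shows "f \<in> O[at s](\<lambda>_. 1)"
proof -
  obtain K where K: "\<And>t. \<bar>s - t\<bar> \<le> 1 \<Longrightarrow> \<bar>f t\<bar> \<le> K"
    using locally_boundedD(2)[OF assms, of 1] by blast
  show ?thesis
  proof (rule landau_o.bigI)
    show "\<forall>\<^sub>F t in at s. norm (f t) \<le> max K 1 * norm (1::real)"
      unfolding eventually_at
    proof (intro exI[of _ 1] conjI ballI impI)
      fix t assume "t \<noteq> s \<and> dist t s < 1"
      then have "\<bar>f t\<bar> \<le> K" by (intro K) (auto simp: dist_real_def)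
      then show "norm (f t) \<le> max K 1 * norm (1::real)" by simp
    qed simp
  qed simp
qed

lemma DERIV_abs_diff:
  assumes "t \<noteq> s"
  shows "((\<lambda>t. \<bar>s - t\<bar>) has_real_derivative - sgn (s - t)) (at t)"
proof -
  have "((\<lambda>t. (s - t)\<^sup>2) has_real_derivative - 2 * (s - t)) (at t)"
    by (auto intro!: derivative_eq_intros)
  from DERIV_chain2[OF DERIV_real_sqrt this]
  have "((\<lambda>t. \<bar>s - t\<bar>) has_real_derivative inverse \<bar>s - t\<bar> / 2 * (- 2 * (s - t))) (at t)"
    using assms by (simp add: real_sqrt_abs)
  moreover have "inverse \<bar>s - t\<bar> / 2 * (- 2 * (s - t)) = - sgn (s - t)"
    using assms by (auto simp: sgn_real_def abs_if field_simps)
  ultimately show ?thesis by simp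
qed

lemma DERIV_sqrt_abs_diff:
  assumes "t \<noteq> s"
  shows "((\<lambda>t. sqrt \<bar>s - t\<bar>) has_real_derivative - sgn (s - t) / (2 * sqrt \<bar>s - t\<bar>)) (at t)"
  using DERIV_chain2[OF DERIV_sqrt_abs DERIV_abs_diff[OF assms]] assms by (simp add: field_simps)

lemma DERIV_sqrt_diff:
  assumes "t \<noteq> s"
  shows "((\<lambda>t. sqrt (s - t)) has_real_derivative - (1 / (2 * sqrt \<bar>s - t\<bar>))) (at t)"
proof -
  have "((\<lambda>t. s - t) has_real_derivative - 1) (at t)"
    by (auto intro!: derivative_eq_intros)
  from DERIV_chain2[OF DERIV_sqrt_abs this] show ?thesis
    using assms by simp
qed

lemma sgn_mult_sqrt_abs: "sgn x * sqrt \<bar>x\<bar> = sqrt x"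
  by (cases "x \<ge> 0") (auto simp: sgn_real_def real_sqrt_minus)

lemma powr_three_halves: "x \<ge> 0 \<Longrightarrow> x powr (3 / 2) = x * sqrt x"
  using powr_add[of x 1 "1 / 2"] by (simp add: powr_half_sqrt)

text \<open>Here \<open>1 - h * u - k * (u * sqrt u)\<close> is \<open>a / aS\<close> as a function
  of \<open>u\<close>, and the numerator is minus its derivative.\<close>

lemma hubble_asymp:
  fixes h k :: real
  assumes "h > 0" "k > 0"
  shows "(\<lambda>u. (h + 3 / 2 * k * sqrt u) / (1 - h * u - k * (u * sqrt u)) - (h + 3 / 2 * k * sqrt u))
    \<in> O[at_right 0](\<lambda>u. u)"
  using assms by real_asymp

lemma perturbation_at_right_0:
  fixes h k :: real
  assumes "h > 0" "k > 0"
  shows "filterlim (\<lambda>u. h * u + k * (u * sqrt u)) (at_right 0) (at_right 0)"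
  using assms by real_asymp

text \<open>Expanding first in \<open>w = 1 - a / aS\<close> gives
  \<open>1 / (1 - w) ^ 3 = 1 + 3 * w + O(w\<^sup>2)\<close> without parameters. The order 3/2 comes
  from the term \<open>k * (u * sqrt u)\<close> of \<open>w\<close>.\<close>

lemma dust_asymp:
  fixes h k :: real
  assumes hk: "h > 0" "k > 0"
  shows "(\<lambda>u. h\<^sup>2 / (1 - h * u - k * (u * sqrt u)) ^ 3 - (h\<^sup>2 + 3 * h ^ 3 * u)) \<in> O[at_right 0](\<lambda>u. u powr (3 / 2))"
proof -
  let ?w = "\<lambda>u. h * u + k * (u * sqrt u)"
  have "(\<lambda>w::real. 1 / (1 - w) ^ 3 - 1 - 3 * w) \<in> O[at_right 0](\<lambda>w. w\<^sup>2)"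
    by real_asymp
  then have "(\<lambda>u. 1 / (1 - ?w u) ^ 3 - 1 - 3 * ?w u) \<in> O[at_right 0](\<lambda>u. (?w u)\<^sup>2)"
    by (rule landau_o.big.compose[OF _ perturbation_at_right_0[OF hk]])
  also have "(\<lambda>u. (?w u)\<^sup>2) \<in> O[at_right 0](\<lambda>u. u powr (3 / 2))"
    using hk by real_asymp
  finally have "(\<lambda>u. h\<^sup>2 * (1 / (1 - ?w u) ^ 3 - 1 - 3 * ?w u)) \<in> O[at_right 0](\<lambda>u. u powr (3 / 2))"
    by simp
  moreover have "(\<lambda>u. 3 * h\<^sup>2 * k * (u * sqrt u)) \<in> O[at_right 0](\<lambda>u. u powr (3 / 2))"
    using hk by real_asymp
  ultimately have "(\<lambda>u. h\<^sup>2 * (1 / (1 - ?w u) ^ 3 - 1 - 3 * ?w u) + 3 * h\<^sup>2 * k * (u * sqrt u))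
      \<in> O[at_right 0](\<lambda>u. u powr (3 / 2))"
    by (rule sum_in_bigo)
  moreover have "h\<^sup>2 * (1 / (1 - ?w u) ^ 3 - 1 - 3 * ?w u) + 3 * h\<^sup>2 * k * (u * sqrt u)
      = h\<^sup>2 / (1 - h * u - k * (u * sqrt u)) ^ 3 - (h\<^sup>2 + 3 * h ^ 3 * u)" for u
    by (simp add: right_diff_distrib distrib_left diff_diff_eq power2_eq_square power3_eq_cube)
  ultimately show ?thesis by simp
qed

text \<open>Expansion in \<open>w\<close> leaves an error of order \<open>w powr (3 / 2)\<close>.
  The larger error O(u) comes from replacing \<open>w\<close> by \<open>h * u\<close> under the
  root.\<close>

lemma chaplygin_asymp:
  fixes h k C :: real
  assumes hk: "h > 0" "k > 0"
  shows "(\<lambda>u. sqrt (C / (1 - h * u - k * (u * sqrt u)) ^ 6 - C) - sqrt C * sqrt (6 * (h * u))) \<in> O[at_right 0](\<lambda>u. u)"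
proof -
  let ?w = "\<lambda>u. h * u + k * (u * sqrt u)"
  have "(\<lambda>w::real. sqrt (1 / (1 - w) ^ 6 - 1) - sqrt (6 * w)) \<in> O[at_right 0](\<lambda>w. w powr (3 / 2))"
    by real_asymp
  then have "(\<lambda>u. sqrt (1 / (1 - ?w u) ^ 6 - 1) - sqrt (6 * ?w u)) \<in> O[at_right 0](\<lambda>u. ?w u powr (3 / 2))"
    by (rule landau_o.big.compose[OF _ perturbation_at_right_0[OF hk]])
  also have "(\<lambda>u. ?w u powr (3 / 2)) \<in> O[at_right 0](\<lambda>u. u)"
    using hk by real_asymp
  finally have "(\<lambda>u. sqrt (1 / (1 - ?w u) ^ 6 - 1) - sqrt (6 * ?w u)) \<in> O[at_right 0](\<lambda>u. u)" .
  moreover have "(\<lambda>u. sqrt (6 * ?w u) - sqrt (6 * (h * u))) \<in> O[at_right 0](\<lambda>u. u)"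
    using hk by real_asymp
  ultimately have "(\<lambda>u. (sqrt (1 / (1 - ?w u) ^ 6 - 1) - sqrt (6 * ?w u)) + (sqrt (6 * ?w u) - sqrt (6 * (h * u))))
      \<in> O[at_right 0](\<lambda>u. u)"
    by (rule sum_in_bigo)
  then have "(\<lambda>u. sqrt C * (sqrt (1 / (1 - ?w u) ^ 6 - 1) - sqrt (6 * (h * u)))) \<in> O[at_right 0](\<lambda>u. u)"
    by simp
  moreover have "sqrt C * (sqrt (1 / (1 - ?w u) ^ 6 - 1) - sqrt (6 * (h * u)))
      = sqrt (C / (1 - h * u - k * (u * sqrt u)) ^ 6 - C) - sqrt C * sqrt (6 * (h * u))" for u
    by (simp add: right_diff_distrib diff_diff_eq flip: real_sqrt_mult)
  ultimately show ?thesis by simp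
qed

lemma regular_add:
  assumes "sqrt_singular s f" "sqrt_singular s g" "test_fun \<phi>"
  shows "regular (\<lambda>t. f t + g t) \<phi> = regular f \<phi> + regular g \<phi>"
  using assms integrable_mult_test_fun(1)[OF sqrt_singular_integrable]
  by (simp add: regular_def distrib_right)

lemma regular_cmult: "regular (\<lambda>t. C * f t) \<phi> = C * regular f \<phi>"
  by (simp add: regular_def mult.assoc)

lemma distr_eq_uptoI:
  assumes "sqrt_singular s r" "r \<in> O[at s](g)"
    and "\<And>\<phi>. test_fun \<phi> \<Longrightarrow> S \<phi> = T \<phi> + regular r \<phi>"
  shows "distr_eq_upto b c s g S T"
  unfolding distr_eq_upto_def locally_integrable_on_def distr_eq_on_def
  using assms sqrt_singular_integrable[OF assms(1)] by (intro exI[of _ r]) auto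


theorem mainTheorem1:
  fixes A B \<rho>m0 aS HS tS b c :: real
    and a H Hd_reg \<rho>m p_reg \<rho>_reg \<eta> :: "real \<Rightarrow> real"
    and Hdot pACh F :: functional
  assumes A: "A > 0" and B: "B > 0" and \<rho>m0: "\<rho>m0 > 0"
    and aS: "aS = (B / A) powr (1 / 6)"
    and HS: "HS = sqrt (\<rho>m0 / aS ^ 3)"
    and interval: "b < tS" "tS < c"
    \<comment> \<open>leading terms of the cosmological quantities\<close>
    and a: "\<And>t. a t = aS - sqrt (\<rho>m0 / aS) * \<bar>tS - t\<bar>
                        - sqrt (2 * A * aS\<^sup>2 / (3 * HS)) * \<bar>tS - t\<bar> powr (3 / 2)"
    and H: "\<And>t. H t = HS * sgn (tS - t) + sqrt (3 * A / (2 * HS)) * sgn (tS - t) * sqrt \<bar>tS - t\<bar>"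
    and Hd_reg: "\<And>t. Hd_reg t = - sqrt (3 * A / (8 * HS)) * (1 / sqrt \<bar>tS - t\<bar>)"
    and Hdot: "Hdot = (\<lambda>\<phi>. - 2 * HS * dirac tS \<phi> + regular Hd_reg \<phi>)"
    and \<rho>m: "\<And>t. \<rho>m t = HS\<^sup>2 + 3 * HS ^ 3 * \<bar>tS - t\<bar>"
    \<comment> \<open>anti-Chaplygin gas: leading terms without \<open>\<delta>\<close>, and the pressure with its \<open>\<delta>\<close>-term\<close>
    and \<rho>_reg: "\<And>t. \<rho>_reg t = sqrt (6 * A * HS * \<bar>tS - t\<bar>)"
    and p_reg: "\<And>t. p_reg t = sqrt (A / (6 * HS * \<bar>tS - t\<bar>))"
    and pACh: "pACh = (\<lambda>\<phi>. regular p_reg \<phi> + 4 / 3 * HS * dirac tS \<phi>)"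
    \<comment> \<open>regularization\<close>
    and \<eta>: "mollifier \<eta>"
    \<comment> \<open>the equation of state as an outer distribution: any distribution extending \<open>A / x\<close>, \<open>x > 0\<close>\<close>
    and F: "is_distribution F" "distr_eq_on {0<..} F (regular (\<lambda>x. A / x))"
  shows
    "\<comment> \<open>the leading terms are those of \<open>H = a'/a\<close>, its derivative, and the two energy densities\<close>
    distr_eq_on {b<..<c} (distr_deriv (regular a)) (regular (deriv a)) \<and>
    ((\<lambda>t. deriv a t / a t - H t) \<in> O[at tS](\<lambda>t. \<bar>tS - t\<bar>)) \<and>
    (distr_eq_on {b<..<c} (distr_deriv (regular H)) Hdot) \<and>
    ((\<lambda>t. \<rho>m0 / a t ^ 3 - \<rho>m t) \<in> O[at tS](\<lambda>t. \<bar>tS - t\<bar> powr (3 / 2))) \<and>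
    ((\<lambda>t. sqrt (B / a t ^ 6 - A) - \<rho>_reg t) \<in> O[at tS](\<lambda>t. \<bar>tS - t\<bar>)) \<and>
    \<comment> \<open>(b) the \<open>\<delta>\<close>-term in \<open>3 H p\<close> vanishes\<close>
    (has_product_on \<eta> b c (\<lambda>\<phi>. 3 * regular H \<phi>) (\<lambda>\<phi>. 4 / 3 * HS * dirac tS \<phi>) (\<lambda>\<phi>. 0)) \<and>
    (has_product_on \<eta> b c (\<lambda>\<phi>. 3 * regular H \<phi>) pACh (regular (\<lambda>t. 3 * H t * p_reg t))) \<and>
    \<comment> \<open>(c) the \<open>\<delta>\<close>-term of \<open>H'\<close> is compensated by the \<open>\<delta>\<close>-term of the pressure\<close>
    (distr_eq_on {b<..<c} (\<lambda>\<phi>. distr_deriv (regular H) \<phi> - regular Hd_reg \<phi>)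
                          (\<lambda>\<phi>. - 2 * HS * dirac tS \<phi>)) \<and>
    (distr_eq_on {b<..<c} (\<lambda>\<phi>. distr_deriv (regular H) \<phi> - regular Hd_reg \<phi>)
                          (\<lambda>\<phi>. - 3 / 2 * (pACh \<phi> - regular p_reg \<phi>))) \<and>
    (\<exists>\<rho>ACh.
       has_composition_on \<eta> b c F pACh \<rho>ACh \<and>
       \<comment> \<open>(a) \<open>\<rho>ACh\<close> is a continuous function vanishing at \<open>tS\<close>, the same as without \<open>\<delta>\<close>-term\<close>
       continuous_on UNIV \<rho>_reg \<and> \<rho>_reg tS = 0 \<and>
       distr_eq_on {b<..<c} \<rho>ACh (regular \<rho>_reg) \<and>
       has_composition_on \<eta> b c F (regular p_reg) \<rho>ACh \<and>
       distr_eq_on {b<..<c} (distr_deriv \<rho>ACh) (regular (deriv \<rho>_reg)) \<and>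
       \<comment> \<open>Friedmann equation\<close>
       (\<exists>H2. has_product_on \<eta> b c (regular H) (regular H) H2 \<and>
             distr_eq_upto b c tS (\<lambda>t. \<bar>tS - t\<bar>) H2 (\<lambda>\<phi>. regular \<rho>m \<phi> + \<rho>ACh \<phi>)) \<and>
       \<comment> \<open>Raychaudhuri equation\<close>
       distr_eq_upto b c tS (\<lambda>t. 1)
         Hdot (\<lambda>\<phi>. - 3 / 2 * (regular \<rho>m \<phi> + \<rho>ACh \<phi> + pACh \<phi>)) \<and>
       \<comment> \<open>continuity equation\<close>
       (\<exists>Q. has_product_on \<eta> b c (\<lambda>\<phi>. 3 * regular H \<phi>) (\<lambda>\<phi>. \<rho>ACh \<phi> + pACh \<phi>) Q \<and>
            distr_eq_upto b c tS (\<lambda>t. 1) (\<lambda>\<phi>. distr_deriv \<rho>ACh \<phi> + Q \<phi>) (\<lambda>\<phi>. 0)))"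
proof -

  \<comment> \<open>Leading coefficients in terms of \<open>HS\<close>, \<open>k\<close> and
    \<open>aS\<close>\<close>
  define k where "k = sqrt (2 * A / (3 * HS))"
  have aS_pos: "aS > 0" and aS6: "aS ^ 6 = B / A"
    using A B by (auto simp: aS powr_power)
  have h: "HS > 0" and h2: "HS\<^sup>2 = \<rho>m0 / aS ^ 3"
    using \<rho>m0 aS_pos by (auto simp: HS)
  have k: "k > 0" and k2: "k\<^sup>2 = 2 * A / (3 * HS)"
    using A h by (auto simp: k_def)
  have A_eq: "A = 3 / 2 * HS * k\<^sup>2"
    using h by (simp add: k2)
  have coeffs:
    "sqrt (\<rho>m0 / aS) = aS * HS" "sqrt (2 * A * aS\<^sup>2 / (3 * HS)) = aS * k"
    "sqrt (3 * A / (2 * HS)) = 3 / 2 * k" "sqrt (3 * A / (8 * HS)) = 3 / 4 * k"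
    "sqrt (A / (6 * HS * u)) = k / 2 * (1 / sqrt u)"
    "sqrt (6 * A * HS * u) = 3 * HS * k * sqrt u" for u
  proof -
    have "(aS * HS)\<^sup>2 = aS\<^sup>2 * (\<rho>m0 / aS ^ 3)"
      by (simp only: power_mult_distrib h2)
    also have "\<dots> = \<rho>m0 / aS"
      using aS_pos by (simp add: power2_eq_square power3_eq_cube)
    finally show "sqrt (\<rho>m0 / aS) = aS * HS"
      using aS_pos h by (metis less_imp_le mult_nonneg_nonneg real_sqrt_unique)
    have "(aS * k)\<^sup>2 = 2 * A * aS\<^sup>2 / (3 * HS)"
      by (simp add: power_mult_distrib k2)
    then show "sqrt (2 * A * aS\<^sup>2 / (3 * HS)) = aS * k"
      using aS_pos k by (metis less_imp_le mult_nonneg_nonneg real_sqrt_unique)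
    \<comment> \<open>By \<open>A_eq\<close> each radicand is a perfect square, up to a factor
      \<open>u\<close> or \<open>1 / u\<close>.\<close>
    have eqs: "3 * A / (2 * HS) = (3 / 2 * k)\<^sup>2" "3 * A / (8 * HS) = (3 / 4 * k)\<^sup>2"
      "A / (6 * HS * u) = (k / 2)\<^sup>2 * (1 / u)" "6 * A * HS * u = (3 * HS * k)\<^sup>2 * u"
      using h by (simp_all add: A_eq power2_eq_square)
    show "sqrt (3 * A / (2 * HS)) = 3 / 2 * k" "sqrt (3 * A / (8 * HS)) = 3 / 4 * k"
      "sqrt (A / (6 * HS * u)) = k / 2 * (1 / sqrt u)"
      "sqrt (6 * A * HS * u) = 3 * HS * k * sqrt u"
      unfolding eqs using h k by (simp_all add: real_sqrt_mult real_sqrt_divide)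
  qed
  have a_eq: "a = (\<lambda>t. aS * (1 - HS * \<bar>tS - t\<bar> - k * (\<bar>tS - t\<bar> * sqrt \<bar>tS - t\<bar>)))"
    unfolding fun_eq_iff a coeffs by (simp add: powr_three_halves algebra_simps)
  \<comment> \<open>Odd \<open>sqrt\<close> absorbs the sign, so \<open>H\<close> is a pure jump
    plus a continuous function. This separates the delta-term of its derivative from the regular
    part.\<close>
  have H_eq: "H = (\<lambda>t. HS * sgn (tS - t) + 3 / 2 * k * sqrt (tS - t))"
    unfolding fun_eq_iff H coeffs by (simp add: sgn_mult_sqrt_abs mult.assoc)
  have Hd_eq: "Hd_reg = (\<lambda>t. - (3 / 4 * k) * (1 / sqrt \<bar>tS - t\<bar>))"
    unfolding fun_eq_iff Hd_reg coeffs by simp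
  have p_eq: "p_reg = (\<lambda>t. k / 2 * (1 / sqrt \<bar>tS - t\<bar>))"
    unfolding fun_eq_iff p_reg coeffs by simp
  have \<rho>_eq: "\<rho>_reg = (\<lambda>t. 3 * HS * k * sqrt \<bar>tS - t\<bar>)"
    unfolding fun_eq_iff \<rho>_reg coeffs by simp
  have \<rho>m_eq: "\<rho>m = (\<lambda>t. HS\<^sup>2 + 3 * HS ^ 3 * \<bar>tS - t\<bar>)"
    by (simp add: fun_eq_iff \<rho>m)

  \<comment> \<open>Regularity classes and classical derivatives off the singularity\<close>
  have const: "locally_bounded tS (\<lambda>_. C)" for C
    by (rule isCont_imp_locally_bounded) simp
  have H_bdd: "locally_bounded tS H"
    unfolding H_eq
    by (intro locally_bounded_add locally_bounded_mult const locally_bounded_sgn)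
       (auto intro!: isCont_imp_locally_bounded continuous_intros)
  have H3_bdd: "locally_bounded tS (\<lambda>t. 3 * H t)"
    by (rule locally_bounded_mult[OF const H_bdd])
  have H3_odd: "3 * H (2 * tS - t) = - (3 * H t)" for t
    using sgn_minus[of "tS - t"] real_sqrt_minus[of "tS - t"] by (simp add: H_eq)
  have \<rho>_cont: "isCont \<rho>_reg t" and \<rho>m_cont: "isCont \<rho>m t" for t
    unfolding \<rho>_eq \<rho>m_eq by (intro continuous_intros)+
  note \<rho>_bdd = isCont_imp_locally_bounded[OF \<rho>_cont] and \<rho>m_bdd = isCont_imp_locally_bounded[OF \<rho>m_cont]
  note H_sing = locally_bounded_imp_singular[OF H_bdd]
    and \<rho>_sing = locally_bounded_imp_singular[OF \<rho>_bdd]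
    and \<rho>m_sing = locally_bounded_imp_singular[OF \<rho>m_bdd]
  have sing: "sqrt_singular tS (\<lambda>t. C * (1 / sqrt \<bar>tS - t\<bar>))" for C
    by (rule locally_bounded_mult_singular[OF const sqrt_singular_inverse_sqrt])
  have p_sing: "sqrt_singular tS p_reg" and Hd_sing: "sqrt_singular tS Hd_reg"
    unfolding p_eq Hd_eq by (rule sing)+

  define a' where "a' t = aS * ((HS + 3 / 2 * k * sqrt \<bar>tS - t\<bar>) * sgn (tS - t))" for t
  define \<rho>' where "\<rho>' t = - (3 / 2 * HS * k) * (sgn (tS - t) * (1 / sqrt \<bar>tS - t\<bar>))" for t
  have a'_sing: "sqrt_singular tS a'"
    unfolding a'_def
    by (intro locally_bounded_imp_singular locally_bounded_mult const locally_bounded_sgn)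
       (auto intro!: isCont_imp_locally_bounded continuous_intros)
  have \<rho>'_sing: "sqrt_singular tS \<rho>'"
    unfolding \<rho>'_def
    by (intro locally_bounded_mult_singular const locally_bounded_sgn sqrt_singular_inverse_sqrt)
  have a_cont: "isCont a t" for t
    unfolding a_eq by (intro continuous_intros)
  have a_der: "(a has_real_derivative a' t) (at t)" if "t \<noteq> tS" for t
  proof -
    note abs = DERIV_abs_diff[OF that] and sqrt = DERIV_sqrt_abs_diff[OF that]
    have "- sgn (tS - t) / (2 * sqrt \<bar>tS - t\<bar>) * \<bar>tS - t\<bar>
        = - (sgn (tS - t) / 2) * (\<bar>tS - t\<bar> / sqrt \<bar>tS - t\<bar>)"
      by simp
    also have "\<dots> = - (sgn (tS - t) / 2) * sqrt \<bar>tS - t\<bar>"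
      by (simp only: real_div_sqrt[OF abs_ge_zero])
    finally have q: "aS * (0 - HS * - sgn (tS - t) - k * (- sgn (tS - t) * sqrt \<bar>tS - t\<bar>
        + - sgn (tS - t) / (2 * sqrt \<bar>tS - t\<bar>) * \<bar>tS - t\<bar>)) = a' t"
      by (simp only: a'_def) (simp add: algebra_simps)
    show ?thesis
      using DERIV_cmult[OF DERIV_diff[OF DERIV_diff[OF DERIV_const DERIV_cmult[OF abs]]
            DERIV_cmult[OF DERIV_mult[OF abs sqrt]]], of aS 1 HS k]
      unfolding q a_eq .
  qed
  have \<rho>_der: "(\<rho>_reg has_real_derivative \<rho>' t) (at t)" if "t \<noteq> tS" for t
    unfolding \<rho>_eq \<rho>'_def
    using DERIV_cmult[OF DERIV_sqrt_abs_diff[OF that], of "3 * HS * k"] by simp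

  \<comment> \<open>Distributional derivatives\<close>
  have deriv_a: "distr_deriv (regular a) \<phi> = regular (deriv a) \<phi>" if "test_fun \<phi>" for \<phi>
    using distr_deriv_regular[OF a_cont a_der sqrt_singular_integrable[OF a'_sing] that]
      regular_eq_off_point[of tS "deriv a" a'] DERIV_imp_deriv[OF a_der] by simp
  have deriv_\<rho>: "distr_deriv (regular \<rho>_reg) \<phi> = regular (deriv \<rho>_reg) \<phi>"
    "regular (deriv \<rho>_reg) \<phi> = regular \<rho>' \<phi>" if "test_fun \<phi>" for \<phi>
    using distr_deriv_regular[OF \<rho>_cont \<rho>_der sqrt_singular_integrable[OF \<rho>'_sing] that]
      regular_eq_off_point[of tS "deriv \<rho>_reg" \<rho>'] DERIV_imp_deriv[OF \<rho>_der] by simp_all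
  have deriv_H: "distr_deriv (regular H) \<phi> = Hdot \<phi>" if \<phi>: "test_fun \<phi>" for \<phi>
  proof -
    let ?g = "\<lambda>t. 3 / 2 * k * sqrt (tS - t)"
    have g_cont: "isCont ?g t" for t
      by (intro continuous_intros)
    have g_der: "(?g has_real_derivative Hd_reg t) (at t)" if "t \<noteq> tS" for t
      unfolding Hd_eq using DERIV_cmult[OF DERIV_sqrt_diff[OF that], of "3 / 2 * k"] by simp
    have int: "integrable lborel (\<lambda>t. sgn (tS - t) * deriv \<phi> t)" "integrable lborel (\<lambda>t. ?g t * deriv \<phi> t)"
      by (rule integrable_mult_test_fun(2)[OF sqrt_singular_integrable[OF locally_bounded_imp_singular] \<phi>],
          rule locally_bounded_sgn isCont_imp_locally_bounded[OF g_cont])+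
    have "distr_deriv (regular H) \<phi>
        = - (LBINT t. HS * (sgn (tS - t) * deriv \<phi> t) + ?g t * deriv \<phi> t)"
      by (simp add: distr_deriv_def regular_def H_eq algebra_simps)
    also have "\<dots> = HS * distr_deriv (regular (\<lambda>t. sgn (tS - t))) \<phi> + distr_deriv (regular ?g) \<phi>"
      unfolding distr_deriv_def regular_def
      by (subst Bochner_Integration.integral_add[OF integrable_mult_right[OF int(1)] int(2)]) simp
    also have "\<dots> = Hdot \<phi>"
      using distr_deriv_regular[OF g_cont g_der sqrt_singular_integrable[OF Hd_sing] \<phi>]
      by (simp add: distr_deriv_sgn[OF \<phi>] Hdot dirac_def)
    finally show ?thesis .
  qed

  \<comment> \<open>Comparison with the exact expressions\<close>
  have hubble: "(\<lambda>t. deriv a t / a t - H t) \<in> O[at tS](\<lambda>t. \<bar>tS - t\<bar>)"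
  proof -
    let ?f = "\<lambda>u. (HS + 3 / 2 * k * sqrt u) / (1 - HS * u - k * (u * sqrt u)) - (HS + 3 / 2 * k * sqrt u)"
    have "(\<lambda>t. ?f \<bar>tS - t\<bar>) \<in> O[at tS](\<lambda>t. \<bar>tS - t\<bar>)"
      by (rule landau_o.big.compose[OF hubble_asymp[OF h k] filterlim_abs_diff])
    then have "(\<lambda>t. sgn (tS - t) * ?f \<bar>tS - t\<bar>) \<in> O[at tS](\<lambda>t. 1 * \<bar>tS - t\<bar>)"
      by (rule landau_o.big.mult[OF locally_bounded_bigo[OF locally_bounded_sgn]])
    then have big: "(\<lambda>t. sgn (tS - t) * ?f \<bar>tS - t\<bar>) \<in> O[at tS](\<lambda>t. \<bar>tS - t\<bar>)"
      unfolding mult_1 .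
    have ev: "\<forall>\<^sub>F t in at tS. sgn (tS - t) * ?f \<bar>tS - t\<bar> = deriv a t / a t - H t"
    proof -
      have "sgn (tS - t) * ?f \<bar>tS - t\<bar> = deriv a t / a t - H t" if "t \<noteq> tS" for t
      proof -
        have "deriv a t / a t = sgn (tS - t) * ((HS + 3 / 2 * k * sqrt \<bar>tS - t\<bar>)
            / (1 - HS * \<bar>tS - t\<bar> - k * (\<bar>tS - t\<bar> * sqrt \<bar>tS - t\<bar>)))"
          unfolding DERIV_imp_deriv[OF a_der[OF that]] using aS_pos by (simp add: a'_def a_eq)
        moreover have "H t = sgn (tS - t) * (HS + 3 / 2 * k * sqrt \<bar>tS - t\<bar>)"
          unfolding H coeffs by (simp add: algebra_simps)
        ultimately show ?thesis
          by (simp only: right_diff_distrib)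
      qed
      then show ?thesis
        by (auto simp: eventually_at intro: exI[of _ 1])
    qed
    show ?thesis
      by (rule iffD1[OF landau_o.big.in_cong[OF ev] big])
  qed
  have dust: "(\<lambda>t. \<rho>m0 / a t ^ 3 - \<rho>m t) \<in> O[at tS](\<lambda>t. \<bar>tS - t\<bar> powr (3 / 2))"
  proof -
    have "\<rho>m0 / (aS * x) ^ 3 = HS\<^sup>2 / x ^ 3" for x
      by (simp add: h2 power_mult_distrib)
    then show ?thesis
      using landau_o.big.compose[OF dust_asymp[OF h k] filterlim_abs_diff] by (simp add: a_eq \<rho>m_eq)
  qed
  have chaplygin: "(\<lambda>t. sqrt (B / a t ^ 6 - A) - \<rho>_reg t) \<in> O[at tS](\<lambda>t. \<bar>tS - t\<bar>)"
  proof -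
    have "B / (aS * x) ^ 6 = A / x ^ 6" for x
      using A B by (simp add: aS6 power_mult_distrib)
    moreover have "\<rho>_reg t = sqrt A * sqrt (6 * (HS * \<bar>tS - t\<bar>))" for t
      by (simp add: \<rho>_reg mult_ac flip: real_sqrt_mult)
    ultimately show ?thesis
      using landau_o.big.compose[OF chaplygin_asymp[OF h k] filterlim_abs_diff] by (simp add: a_eq)
  qed

  \<comment> \<open>Products with the pressure and the equation of state\<close>
  have S3H: "3 * regular H \<phi> = regular (\<lambda>t. 3 * H t) \<phi>" for \<phi>
    by (simp add: regular_cmult)
  have prod_delta: "has_product_on \<eta> b c (\<lambda>\<phi>. 3 * regular H \<phi>) (\<lambda>\<phi>. 4 / 3 * HS * dirac tS \<phi>) (\<lambda>\<phi>. 0)"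
  proof -
    have "has_product_on \<eta> b c (\<lambda>\<phi>. 3 * regular H \<phi>) (\<lambda>\<phi>. 4 / 3 * HS * dirac tS \<phi>)
        (regular (\<lambda>t. 3 * H t * 0))"
      by (rule has_product_on_regular_dirac[OF \<eta> H3_bdd locally_bounded_imp_singular[OF const] H3_odd S3H,
            where \<kappa> = "4 / 3 * HS"])
         (simp add: regular_def dirac_def)
    then show ?thesis by (simp add: regular_def)
  qed
  have pACh_eq: "pACh \<phi> = regular p_reg \<phi> + 4 / 3 * HS * \<phi> tS" for \<phi>
    by (simp add: pACh dirac_def)
  have prod_p: "has_product_on \<eta> b c (\<lambda>\<phi>. 3 * regular H \<phi>) pACh (regular (\<lambda>t. 3 * H t * p_reg t))"
    by (rule has_product_on_regular_dirac[OF \<eta> H3_bdd p_sing H3_odd S3H pACh_eq])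

  \<comment> \<open>Leaving the weight free gives both claims about the density:
    \<open>4 / 3 * HS\<close> is the actual pressure, and 0 the pressure without its
    delta-term.\<close>
  have comp: "has_composition_on \<eta> b c F T (regular \<rho>_reg)"
    if "\<And>\<phi>. test_fun \<phi> \<Longrightarrow> T \<phi> = regular p_reg \<phi> + \<kappa> * \<phi> tS" "\<kappa> \<ge> 0" for T \<kappa>
  proof (rule has_composition_on_reciprocal[OF \<eta> less_imp_le[OF A] p_sing that(2) _ \<rho>_bdd _ F that(1)])
    fix R :: real
    \<comment> \<open>The pressure decreases with the distance from \<open>tS\<close>;
      \<open>\<bar>R\<bar> + 1\<close> is a positive upper bound for that distance for every real
      \<open>R\<close>.\<close>
    have "k / 2 * (1 / sqrt (\<bar>R\<bar> + 1)) \<le> p_reg t" if "t \<noteq> tS" "\<bar>tS - t\<bar> \<le> R" for t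
      unfolding p_eq using k that by (intro mult_left_mono divide_left_mono mult_pos_pos) auto
    then show "\<exists>m>0. \<forall>t. t \<noteq> tS \<longrightarrow> \<bar>tS - t\<bar> \<le> R \<longrightarrow> m \<le> p_reg t"
      using k by (intro exI[of _ "k / 2 * (1 / sqrt (\<bar>R\<bar> + 1))"]) auto
  next
    \<comment> \<open>True at \<open>tS\<close> too, by the convention for division by zero: both
      sides are 0.\<close>
    show "\<rho>_reg t = A / p_reg t" for t
      using k by (simp add: \<rho>_eq p_eq A_eq power2_eq_square)
  qed
  have comp_p: "has_composition_on \<eta> b c F pACh (regular \<rho>_reg)"
    by (rule comp[OF pACh_eq]) (use h in simp)
  have comp_reg: "has_composition_on \<eta> b c F (regular p_reg) (regular \<rho>_reg)"
    by (rule comp[of _ 0]) auto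

  \<comment> \<open>The three cosmological equations\<close>
  have friedmann: "\<exists>H2. has_product_on \<eta> b c (regular H) (regular H) H2 \<and>
      distr_eq_upto b c tS (\<lambda>t. \<bar>tS - t\<bar>) H2 (\<lambda>\<phi>. regular \<rho>m \<phi> + regular \<rho>_reg \<phi>)"
  proof (intro exI conjI)
    show "has_product_on \<eta> b c (regular H) (regular H) (regular (\<lambda>t. H t * H t))"
      by (rule has_product_on_regular_dirac[OF \<eta> H_bdd H_sing, of 0]) auto
    \<comment> \<open>The constant and square root terms cancel. The first summand is the square of
      the second term of \<open>H\<close>, the other comes from the linear term of
      \<open>\<rho>m\<close>.\<close>
    let ?r = "\<lambda>t. (9 / 4 * k\<^sup>2 - 3 * HS ^ 3) * \<bar>tS - t\<bar>"
    have r_sing: "sqrt_singular tS ?r"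
      by (intro locally_bounded_imp_singular isCont_imp_locally_bounded continuous_intros)
    \<comment> \<open>At \<open>tS\<close> the identity fails, because \<open>sgn 0 = 0\<close>
      makes \<open>H\<close> vanish there.\<close>
    have HH: "H t * H t = (\<rho>m t + \<rho>_reg t) + ?r t" if "t \<noteq> tS" for t
    proof -
      have "sgn (tS - t) * sgn (tS - t) = 1" "sgn (tS - t) * sqrt (tS - t) = sqrt \<bar>tS - t\<bar>"
        "sqrt (tS - t) * sqrt (tS - t) = \<bar>tS - t\<bar>"
        using that by (auto simp: sgn_real_def abs_if simp flip: real_sqrt_minus)
      then show ?thesis
        unfolding H_eq \<rho>_eq \<rho>m_eq by algebra
    qed
    show "distr_eq_upto b c tS (\<lambda>t. \<bar>tS - t\<bar>) (regular (\<lambda>t. H t * H t))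
        (\<lambda>\<phi>. regular \<rho>m \<phi> + regular \<rho>_reg \<phi>)"
    proof (rule distr_eq_uptoI[OF r_sing])
      fix \<phi> assume \<phi>: "test_fun \<phi>"
      show "regular (\<lambda>t. H t * H t) \<phi> = regular \<rho>m \<phi> + regular \<rho>_reg \<phi> + regular ?r \<phi>"
      proof -
        have "regular (\<lambda>t. H t * H t) = regular (\<lambda>t. (\<rho>m t + \<rho>_reg t) + ?r t)"
          by (rule regular_eq_off_point) (rule HH)
        then show ?thesis
          unfolding regular_add[OF \<rho>m_sing \<rho>_sing \<phi>, symmetric]
            regular_add[OF sqrt_singular_add[OF \<rho>m_sing \<rho>_sing] r_sing \<phi>, symmetric] by simp
      qed
    qed simp
  qed

  have raychaudhuri: "distr_eq_upto b c tS (\<lambda>t. 1)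
      Hdot (\<lambda>\<phi>. - 3 / 2 * (regular \<rho>m \<phi> + regular \<rho>_reg \<phi> + pACh \<phi>))"
  proof -
    \<comment> \<open>The delta-terms and the inverse square roots cancel exactly, so only the
      bounded energy densities remain.\<close>
    let ?r = "\<lambda>t. 3 / 2 * (\<rho>m t + \<rho>_reg t)"
    have r_bdd: "locally_bounded tS ?r"
      by (intro locally_bounded_mult locally_bounded_add const \<rho>m_bdd \<rho>_bdd)
    have Hd_p: "Hd_reg = (\<lambda>t. - 3 / 2 * p_reg t)"
      by (simp add: fun_eq_iff Hd_eq p_eq)
    show ?thesis
    proof (rule distr_eq_uptoI[OF locally_bounded_imp_singular[OF r_bdd] locally_bounded_bigo[OF r_bdd]])
      fix \<phi> assume \<phi>: "test_fun \<phi>"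
      have "regular ?r \<phi> = 3 / 2 * (regular \<rho>m \<phi> + regular \<rho>_reg \<phi>)"
        unfolding regular_cmult regular_add[OF \<rho>m_sing \<rho>_sing \<phi>] ..
      moreover have "regular Hd_reg \<phi> = - 3 / 2 * regular p_reg \<phi>"
        unfolding Hd_p regular_cmult ..
      ultimately show "Hdot \<phi> = - 3 / 2 * (regular \<rho>m \<phi> + regular \<rho>_reg \<phi> + pACh \<phi>) + regular ?r \<phi>"
        by (simp add: Hdot pACh_eq dirac_def algebra_simps)
    qed
  qed

  have continuity: "\<exists>Q. has_product_on \<eta> b c (\<lambda>\<phi>. 3 * regular H \<phi>) (\<lambda>\<phi>. regular \<rho>_reg \<phi> + pACh \<phi>) Q \<and>
      distr_eq_upto b c tS (\<lambda>t. 1) (\<lambda>\<phi>. distr_deriv (regular \<rho>_reg) \<phi> + Q \<phi>) (\<lambda>\<phi>. 0)"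
  proof (intro exI conjI)
    let ?g = "\<lambda>t. \<rho>_reg t + p_reg t"
    note g_sing = sqrt_singular_add[OF \<rho>_sing p_sing]
    note Q_sing = locally_bounded_mult_singular[OF H3_bdd g_sing]
    have "regular \<rho>_reg \<phi> + pACh \<phi> = regular ?g \<phi> + 4 / 3 * HS * \<phi> tS" if "test_fun \<phi>" for \<phi>
      using regular_add[OF \<rho>_sing p_sing that] by (simp add: pACh_eq)
    then show "has_product_on \<eta> b c (\<lambda>\<phi>. 3 * regular H \<phi>) (\<lambda>\<phi>. regular \<rho>_reg \<phi> + pACh \<phi>)
        (regular (\<lambda>t. 3 * H t * ?g t))"
      by (rule has_product_on_regular_dirac[OF \<eta> H3_bdd g_sing H3_odd S3H])
    \<comment> \<open>The inverse square roots of \<open>\<rho>'\<close> and of the jump part of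
      \<open>3 * H * p_reg\<close> cancel. The first summand is the second term of \<open>H\<close>
      times the pressure, whose square roots multiply to a sign.\<close>
    let ?r = "\<lambda>t. 9 / 4 * k\<^sup>2 * sgn (tS - t) + 3 * H t * \<rho>_reg t"
    have r_bdd: "locally_bounded tS ?r"
      by (rule locally_bounded_add[OF locally_bounded_mult[OF const locally_bounded_sgn]
            locally_bounded_mult[OF H3_bdd \<rho>_bdd]])
    have r_eq: "\<rho>' t + 3 * H t * ?g t = ?r t" if "t \<noteq> tS" for t
    proof -
      have cancel: "- (3 / 2 * HS * k) * (\<sigma> * y) + 3 * (HS * \<sigma> + 3 / 2 * k * x) * (r + k / 2 * y)
          = 9 / 4 * k\<^sup>2 * \<sigma> + 3 * (HS * \<sigma> + 3 / 2 * k * x) * r" if "x * y = \<sigma>" for x y r \<sigma>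
        by (simp add: that[symmetric] power2_eq_square field_simps)
      have "sqrt (tS - t) * (1 / sqrt \<bar>tS - t\<bar>) = sgn (tS - t)"
        using that by (simp add: sgn_mult_sqrt_abs[of "tS - t", symmetric])
      from cancel[OF this] show ?thesis
        unfolding \<rho>'_def p_eq H_eq .
    qed
    show "distr_eq_upto b c tS (\<lambda>t. 1)
        (\<lambda>\<phi>. distr_deriv (regular \<rho>_reg) \<phi> + regular (\<lambda>t. 3 * H t * ?g t) \<phi>) (\<lambda>\<phi>. 0)"
    proof (rule distr_eq_uptoI[OF locally_bounded_imp_singular[OF r_bdd] locally_bounded_bigo[OF r_bdd]])
      fix \<phi> assume \<phi>: "test_fun \<phi>"
      show "distr_deriv (regular \<rho>_reg) \<phi> + regular (\<lambda>t. 3 * H t * ?g t) \<phi> = 0 + regular ?r \<phi>"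
      proof -
        have "regular (\<lambda>t. \<rho>' t + 3 * H t * ?g t) = regular ?r"
          by (rule regular_eq_off_point) (rule r_eq)
        then show ?thesis
          using regular_add[OF \<rho>'_sing Q_sing \<phi>] deriv_\<rho>[OF \<phi>] by (simp only: add_0)
      qed
    qed
  qed

  have eqs:
    "distr_eq_on {b<..<c} (distr_deriv (regular a)) (regular (deriv a))"
    "distr_eq_on {b<..<c} (distr_deriv (regular H)) Hdot"
    "distr_eq_on {b<..<c} (\<lambda>\<phi>. distr_deriv (regular H) \<phi> - regular Hd_reg \<phi>)
      (\<lambda>\<phi>. - 2 * HS * dirac tS \<phi>)"
    "distr_eq_on {b<..<c} (\<lambda>\<phi>. distr_deriv (regular H) \<phi> - regular Hd_reg \<phi>)
      (\<lambda>\<phi>. - 3 / 2 * (pACh \<phi> - regular p_reg \<phi>))"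
    "distr_eq_on {b<..<c} (regular \<rho>_reg) (regular \<rho>_reg)"
    "distr_eq_on {b<..<c} (distr_deriv (regular \<rho>_reg)) (regular (deriv \<rho>_reg))"
    by (simp_all add: distr_eq_on_def deriv_a deriv_H deriv_\<rho>(1) Hdot pACh)
  have "continuous_on UNIV \<rho>_reg" "\<rho>_reg tS = 0"
    using \<rho>_cont by (auto simp: continuous_at_imp_continuous_on \<rho>_eq)
  \<comment> \<open>The density is witnessed by \<open>regular \<rho>_reg\<close>, which makes its
    equality with the continuous function reflexive.\<close>
  then show ?thesis
    using eqs hubble dust chaplygin prod_delta prod_p comp_p comp_reg friedmann raychaudhuri continuity
    by (intro conjI) (assumption | rule exI[of _ "regular \<rho>_reg"], (intro conjI; assumption))+
qed

end
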